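(* Let $k$ be an algebraically closed field of characteristic $0$ and let $H$ be a finite dimensional Frobenius weak Hopf algebra over $k$ such that $S^2|_{H_{\min}}=\mathrm{id}$. Let $I$ be the set of primitive idempotents of the commutative algebra $H_s\cap Z(H)$. If $\mathrm{Tr}(S^2|_{pH})\neq0$ for all $p\in I$, then $H$ is semisimple.
   Context: A weak Hopf algebra over a field $k$ is a $k$-vector space $H$ with an associative unital algebra structure $(m,1)$, a coassociative counital coalgebra structure $(\Delta,\epsilon)$ (Sweedler notation $\Delta(h)=h_{(1)}\otimes h_{(2)}$) and a linear map $S:H\to H$ (antipode) such that for all $f,g,h\in H$: $\Delta(hg)=\Delta(h)\Delta(g)$; $(\Delta\otimes\mathrm{id})\Delta(1)=(\Delta(1)\otimes1)(1\otimes\Delta(1))=(1\otimes\Delta(1))(\Delta(1)\otimes1)$; $\epsilon(fgh)=\epsilon(fg_{(1)})\epsilon(g_{(2)}h)=\epsilon(fg_{(2)})\epsilon(g_{(1)}h)$; $m(\mathrm{id}\otimes S)\Delta(h)=(\epsilon\otimes\mathrm{id})(\Delta(1)(h\otimes1))$; $m(S\otimes\mathrm{id})\Delta(h)=(\mathrm{id}\otimes\epsilon)((1\otimes h)\Delta(1))$; $S(h)=S(h_{(1)})h_{(2)}S(h_{(3)})$. ($\Delta(1)\neq1\otimes1$ in general.) Bases: $H_t=\varepsilon_t(H)$, $H_s=\varepsilon_s(H)$, where $\varepsilon_t(h)=\epsilon(1_{(1)}h)1_{(2)}$, $\varepsilon_s(h)=1_{(1)}\epsilon(h1_{(2)})$;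 they are commuting separable subalgebras, and $H_{\min}=H_tH_s$. $Z(H)$ is the center of $H$. $H$ is called Frobenius if it is a Frobenius algebra; semisimple means semisimple as an algebra. *)

theory Defs
  imports
    "HOL-Library.Poly_Mapping"
    "HOL-Computational_Algebra.Polynomial"
begin

section \<open>Tensors as formal sums modulo multilinearity\<close>

text \<open>
  For a \<open>k\<close>-vector space \<open>H\<close>, the space \<open>H \<otimes> H\<close> is the quotient of the free vector space on
  \<open>H \<times> H\<close> by the subspace spanned by the bilinearity relations, and similarly for
  \<open>H \<otimes> H \<otimes> H\<close>.  Since HOL has no types depending on the scalar multiplication of \<open>H\<close>, tensors
  are handled through representatives in the free vector space, and equality of tensors is the
  congruence \<open>teq2\<close> (resp. \<open>teq3\<close>) modulo the relations.  In particular a linear map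
  \<open>H \<rightarrow> H \<otimes> H\<close> is given by a choice of representatives that is linear up to \<open>teq2\<close>.
\<close>

type_synonym ('k, 'h) tensor2 = "('h \<times> 'h) \<Rightarrow>\<^sub>0 'k"
type_synonym ('k, 'h) tensor3 = "('h \<times> 'h \<times> 'h) \<Rightarrow>\<^sub>0 'k"

definition fscale :: "'k::field \<Rightarrow> ('a \<Rightarrow>\<^sub>0 'k) \<Rightarrow> ('a \<Rightarrow>\<^sub>0 'k)" where
  "fscale c t = Poly_Mapping.map ((*) c) t"

definition pure2 :: "'h \<Rightarrow> 'h \<Rightarrow> ('k::field, 'h) tensor2"  (infix \<open>\<otimes>\<close> 72) where
  "a \<otimes> b = Poly_Mapping.single (a, b) 1"

definition pure3 :: "'h \<Rightarrow> 'h \<Rightarrow> 'h \<Rightarrow> ('k::field, 'h) tensor3"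
    (\<open>(_ \<otimes>\<otimes> _ \<otimes>\<otimes> _)\<close> [73, 73, 73] 72) where
  "a \<otimes>\<otimes> b \<otimes>\<otimes> c = Poly_Mapping.single (a, b, c) 1"

definition relations2 ::
    "('k::field \<Rightarrow> 'h::ab_group_add \<Rightarrow> 'h) \<Rightarrow> ('k, 'h) tensor2 set" where
  "relations2 scale = module.span fscale
     ({(a + a') \<otimes> b - a \<otimes> b - a' \<otimes> b | a a' b. True}
    \<union> {a \<otimes> (b + b') - a \<otimes> b - a \<otimes> b' | a b b'. True}
    \<union> {scale r a \<otimes> b - fscale r (a \<otimes> b) | r a b. True}
    \<union> {a \<otimes> scale r b - fscale r (a \<otimes> b) | r a b. True})"

definition relations3 ::
    "('k::field \<Rightarrow> 'h::ab_group_add \<Rightarrow> 'h) \<Rightarrow> ('k, 'h) tensor3 set" where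
  "relations3 scale = module.span fscale
     ({(a + a') \<otimes>\<otimes> b \<otimes>\<otimes> c - a \<otimes>\<otimes> b \<otimes>\<otimes> c - a' \<otimes>\<otimes> b \<otimes>\<otimes> c | a a' b c. True}
    \<union> {a \<otimes>\<otimes> (b + b') \<otimes>\<otimes> c - a \<otimes>\<otimes> b \<otimes>\<otimes> c - a \<otimes>\<otimes> b' \<otimes>\<otimes> c | a b b' c. True}
    \<union> {a \<otimes>\<otimes> b \<otimes>\<otimes> (c + c') - a \<otimes>\<otimes> b \<otimes>\<otimes> c - a \<otimes>\<otimes> b \<otimes>\<otimes> c' | a b c c'. True}
    \<union> {scale r a \<otimes>\<otimes> b \<otimes>\<otimes> c - fscale r (a \<otimes>\<otimes> b \<otimes>\<otimes> c) | r a b c. True}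
    \<union> {a \<otimes>\<otimes> scale r b \<otimes>\<otimes> c - fscale r (a \<otimes>\<otimes> b \<otimes>\<otimes> c) | r a b c. True}
    \<union> {a \<otimes>\<otimes> b \<otimes>\<otimes> scale r c - fscale r (a \<otimes>\<otimes> b \<otimes>\<otimes> c) | r a b c. True})"

definition teq2 ::
    "('k::field \<Rightarrow> 'h::ab_group_add \<Rightarrow> 'h) \<Rightarrow> ('k, 'h) tensor2 \<Rightarrow> ('k, 'h) tensor2 \<Rightarrow> bool" where
  "teq2 scale t u \<longleftrightarrow> t - u \<in> relations2 scale"

definition teq3 ::
    "('k::field \<Rightarrow> 'h::ab_group_add \<Rightarrow> 'h) \<Rightarrow> ('k, 'h) tensor3 \<Rightarrow> ('k, 'h) tensor3 \<Rightarrow> bool" where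
  "teq3 scale t u \<longleftrightarrow> t - u \<in> relations3 scale"

text \<open>
  \<open>lin_ext s \<beta>\<close> is the linear extension of \<open>\<beta>\<close> from the basis to the free vector space, with values
  in a vector space with scalar multiplication \<open>s\<close>.  If \<open>\<beta>\<close> is multilinear, then this is the map
  induced on the tensor product (see \<open>lin_ext_cong_teq2\<close> below); e.g. \<open>lin_ext s (\<lambda>(a, b). \<beta> a b) (\<Delta> h)\<close> is
  \<open>\<beta> h\<^sub>(\<^sub>1\<^sub>) h\<^sub>(\<^sub>2\<^sub>)\<close> in Sweedler notation.
\<close>

definition lin_ext ::
    "('k::field \<Rightarrow> 'v::ab_group_add \<Rightarrow> 'v) \<Rightarrow> ('a \<Rightarrow> 'v) \<Rightarrow> ('a \<Rightarrow>\<^sub>0 'k) \<Rightarrow> 'v" where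
  "lin_ext s \<beta> t = (\<Sum>x\<in>Poly_Mapping.keys t. s (Poly_Mapping.lookup t x) (\<beta> x))"

lemma lookup_fscale: "Poly_Mapping.lookup (fscale c t) x = c * Poly_Mapping.lookup t x"
  by (simp add: fscale_def Poly_Mapping.map.rep_eq when_def)

lemma vector_space_fscale: "vector_space (fscale :: 'k::field \<Rightarrow> ('a \<Rightarrow>\<^sub>0 'k) \<Rightarrow> ('a \<Rightarrow>\<^sub>0 'k))"
  by unfold_locales
    (auto intro!: poly_mapping_eqI simp: lookup_fscale lookup_add algebra_simps)

lemma lin_ext_super:
  assumes "vector_space s" "finite A" "Poly_Mapping.keys t \<subseteq> A"
  shows "lin_ext s \<beta> t = (\<Sum>x\<in>A. s (Poly_Mapping.lookup t x) (\<beta> x))"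
proof -
  interpret vector_space s by fact
  show ?thesis unfolding lin_ext_def
    by (rule sum.mono_neutral_left) (use assms in \<open>auto simp: in_keys_iff\<close>)
qed

lemma lin_ext_linear:
  assumes "vector_space s"
  shows "Vector_Spaces.linear fscale s (lin_ext s \<beta>)"
proof -
  interpret vector_space s by fact
  interpret F: vector_space "fscale :: 'a \<Rightarrow> ('c \<Rightarrow>\<^sub>0 'a) \<Rightarrow> _" by (rule vector_space_fscale)
  show ?thesis
  proof
    fix t u :: "'c \<Rightarrow>\<^sub>0 'a" and r
    let ?A = "Poly_Mapping.keys t \<union> Poly_Mapping.keys u"
    have "Poly_Mapping.keys (t + u) \<subseteq> ?A" by (rule Poly_Mapping.keys_add)
    then show "lin_ext s \<beta> (t + u) = lin_ext s \<beta> t + lin_ext s \<beta> u"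
      by (simp add: lin_ext_super[OF assms, of ?A] lookup_add scale_left_distrib sum.distrib)
    have "Poly_Mapping.keys (fscale r t) \<subseteq> Poly_Mapping.keys t"
      by (auto simp: in_keys_iff lookup_fscale)
    then show "lin_ext s \<beta> (fscale r t) = s r (lin_ext s \<beta> t)"
      by (simp add: lin_ext_super[OF assms, of "Poly_Mapping.keys t"] lookup_fscale scale_sum_right)
  qed
qed

lemma lin_ext_single: "vector_space s \<Longrightarrow> lin_ext s \<beta> (Poly_Mapping.single x 1) = \<beta> x"
  by (simp add: lin_ext_def vector_space_def)

lemma lin_ext_cong_teq2:
  fixes scale :: "'k::field \<Rightarrow> 'h::ab_group_add \<Rightarrow> 'h"
  assumes "vector_space scale" "vector_space s"
    and "\<And>b. Vector_Spaces.linear scale s (\<lambda>a. \<beta> (a, b))"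
    and "\<And>a. Vector_Spaces.linear scale s (\<lambda>b. \<beta> (a, b))"
    and "teq2 scale t u"
  shows "lin_ext s \<beta> t = lin_ext s \<beta> u"
proof -
  interpret L: Vector_Spaces.linear fscale s "lin_ext s \<beta>" by (rule lin_ext_linear) fact
  interpret A: Vector_Spaces.linear scale s "\<lambda>a. \<beta> (a, b)" for b by fact
  interpret B: Vector_Spaces.linear scale s "\<lambda>b. \<beta> (a, b)" for a by fact
  have "lin_ext s \<beta> x = 0" if "x \<in> relations2 scale" for x
    using that unfolding relations2_def
    by (rule L.eq_0_on_span[rotated])
      (auto simp: L.diff L.scale pure2_def lin_ext_single[OF assms(2)] A.add B.add A.scale B.scale)
  from this[of "t - u"] assms(5) show ?thesis by (simp add: teq2_def L.diff)
qed

definition tmult2 ::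
    "('k::field, 'h::times) tensor2 \<Rightarrow> ('k, 'h) tensor2 \<Rightarrow> ('k, 'h) tensor2" where
  "tmult2 t u =
     lin_ext fscale (\<lambda>(a, b). lin_ext fscale (\<lambda>(c, d). (a * c) \<otimes> (b * d)) u) t"

definition tmult3 ::
    "('k::field, 'h::times) tensor3 \<Rightarrow> ('k, 'h) tensor3 \<Rightarrow> ('k, 'h) tensor3" where
  "tmult3 t u =
     lin_ext fscale (\<lambda>(a, b, c).
       lin_ext fscale (\<lambda>(a', b', c'). (a * a') \<otimes>\<otimes> (b * b') \<otimes>\<otimes> (c * c')) u) t"

definition comult_left ::  \<comment> \<open>\<open>\<Delta> \<otimes> id\<close>\<close>
    "('h \<Rightarrow> ('k::field, 'h) tensor2) \<Rightarrow> ('k, 'h) tensor2 \<Rightarrow> ('k, 'h) tensor3" where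
  "comult_left \<Delta> t =
     lin_ext fscale (\<lambda>(a, b). lin_ext fscale (\<lambda>(c, d). c \<otimes>\<otimes> d \<otimes>\<otimes> b) (\<Delta> a)) t"

definition comult_right ::  \<comment> \<open>\<open>id \<otimes> \<Delta>\<close>\<close>
    "('h \<Rightarrow> ('k::field, 'h) tensor2) \<Rightarrow> ('k, 'h) tensor2 \<Rightarrow> ('k, 'h) tensor3" where
  "comult_right \<Delta> t =
     lin_ext fscale (\<lambda>(a, b). lin_ext fscale (\<lambda>(c, d). a \<otimes>\<otimes> c \<otimes>\<otimes> d) (\<Delta> b)) t"

definition unit_right :: "('k::field, 'h::one) tensor2 \<Rightarrow> ('k, 'h) tensor3" where
    \<comment> \<open>\<open>t \<mapsto> t \<otimes> 1\<close>\<close>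
  "unit_right t = lin_ext fscale (\<lambda>(a, b). a \<otimes>\<otimes> b \<otimes>\<otimes> 1) t"

definition unit_left :: "('k::field, 'h::one) tensor2 \<Rightarrow> ('k, 'h) tensor3" where
    \<comment> \<open>\<open>t \<mapsto> 1 \<otimes> t\<close>\<close>
  "unit_left t = lin_ext fscale (\<lambda>(a, b). 1 \<otimes>\<otimes> a \<otimes>\<otimes> b) t"

definition counit_left ::  \<comment> \<open>\<open>\<epsilon> \<otimes> id\<close>, with \<open>k \<otimes> H\<close> identified with \<open>H\<close>\<close>
    "('k::field \<Rightarrow> 'h::ab_group_add \<Rightarrow> 'h) \<Rightarrow> ('h \<Rightarrow> 'k) \<Rightarrow> ('k, 'h) tensor2 \<Rightarrow> 'h" where
  "counit_left scale \<epsilon> t = lin_ext scale (\<lambda>(a, b). scale (\<epsilon> a) b) t"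

definition counit_right ::  \<comment> \<open>\<open>id \<otimes> \<epsilon>\<close>, with \<open>H \<otimes> k\<close> identified with \<open>H\<close>\<close>
    "('k::field \<Rightarrow> 'h::ab_group_add \<Rightarrow> 'h) \<Rightarrow> ('h \<Rightarrow> 'k) \<Rightarrow> ('k, 'h) tensor2 \<Rightarrow> 'h" where
  "counit_right scale \<epsilon> t = lin_ext scale (\<lambda>(a, b). scale (\<epsilon> b) a) t"


section \<open>Weak Hopf algebras\<close>

text \<open>
  The sort \<open>{ring, monoid_mult}\<close> is that of unital rings in which \<open>0 = 1\<close> is not excluded.
\<close>

locale algebra_over =
  vector_space scale for scale :: "'k::field \<Rightarrow> 'h::{ring, monoid_mult} \<Rightarrow> 'h" +
  assumes scale_mult_left: "scale r x * y = scale r (x * y)"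
    and scale_mult_right: "x * scale r y = scale r (x * y)"

locale weak_hopf_algebra =
  algebra_over scale for scale :: "'k::field \<Rightarrow> 'h::{ring, monoid_mult} \<Rightarrow> 'h" +
  fixes \<Delta> :: "'h \<Rightarrow> ('k, 'h) tensor2"
    and \<epsilon> :: "'h \<Rightarrow> 'k"
    and S :: "'h \<Rightarrow> 'h"
  assumes comult_add: "teq2 scale (\<Delta> (x + y)) (\<Delta> x + \<Delta> y)"
    and comult_scale: "teq2 scale (\<Delta> (scale r x)) (fscale r (\<Delta> x))"
    and counit_linear: "Vector_Spaces.linear scale (*) \<epsilon>"
    and antipode_linear: "Vector_Spaces.linear scale scale S"
    and coassoc: "teq3 scale (comult_left \<Delta> (\<Delta> h)) (comult_right \<Delta> (\<Delta> h))"
    and counit_left: "counit_left scale \<epsilon> (\<Delta> h) = h"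
    and counit_right: "counit_right scale \<epsilon> (\<Delta> h) = h"
    and comult_mult: "teq2 scale (\<Delta> (h * g)) (tmult2 (\<Delta> h) (\<Delta> g))"
    and comult_one1:
      "teq3 scale (comult_left \<Delta> (\<Delta> 1)) (tmult3 (unit_right (\<Delta> 1)) (unit_left (\<Delta> 1)))"
    and comult_one2:
      "teq3 scale (comult_left \<Delta> (\<Delta> 1)) (tmult3 (unit_left (\<Delta> 1)) (unit_right (\<Delta> 1)))"
    and counit_mult1:
      "\<epsilon> (f * g * h) = lin_ext (*) (\<lambda>(g1, g2). \<epsilon> (f * g1) * \<epsilon> (g2 * h)) (\<Delta> g)"
    and counit_mult2:
      "\<epsilon> (f * g * h) = lin_ext (*) (\<lambda>(g1, g2). \<epsilon> (f * g2) * \<epsilon> (g1 * h)) (\<Delta> g)"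
    and antipode_right:
      "lin_ext scale (\<lambda>(h1, h2). h1 * S h2) (\<Delta> h) =
         counit_left scale \<epsilon> (tmult2 (\<Delta> 1) (h \<otimes> 1))"
    and antipode_left:
      "lin_ext scale (\<lambda>(h1, h2). S h1 * h2) (\<Delta> h) =
         counit_right scale \<epsilon> (tmult2 (1 \<otimes> h) (\<Delta> 1))"
    and antipode_antipode:
      "S h = lin_ext scale (\<lambda>(h1, h2, h3). S h1 * h2 * S h3) (comult_left \<Delta> (\<Delta> h))"
begin

definition target_map :: "'h \<Rightarrow> 'h" where  \<comment> \<open>\<open>\<epsilon>\<^sub>t\<close>\<close>
  "target_map h = lin_ext scale (\<lambda>(a, b). scale (\<epsilon> (a * h)) b) (\<Delta> 1)"

definition source_map :: "'h \<Rightarrow> 'h" where  \<comment> \<open>\<open>\<epsilon>\<^sub>s\<close>\<close>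
  "source_map h = lin_ext scale (\<lambda>(a, b). scale (\<epsilon> (h * b)) a) (\<Delta> 1)"

definition target_base :: "'h set" where  \<comment> \<open>\<open>H\<^sub>t\<close>\<close>
  "target_base = target_map ` UNIV"

definition source_base :: "'h set" where  \<comment> \<open>\<open>H\<^sub>s\<close>\<close>
  "source_base = source_map ` UNIV"

definition minimal_part :: "'h set" where  \<comment> \<open>\<open>H\<^sub>m\<^sub>i\<^sub>n\<close>\<close>
  "minimal_part = span {x * y | x y. x \<in> target_base \<and> y \<in> source_base}"

end


section \<open>Algebra notions\<close>

definition center :: "'h::times set" where
  "center = {z. \<forall>h. z * h = h * z}"

definition primitive_idempotents :: "'h::{ring} set \<Rightarrow> 'h set" where
  "primitive_idempotents A = {p \<in> A. p * p = p \<and> p \<noteq> 0 \<and>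
     (\<forall>e\<in>A. \<forall>f\<in>A. e * e = e \<and> f * f = f \<and> e * f = 0 \<and> f * e = 0 \<and> p = e + f
        \<longrightarrow> e = 0 \<or> f = 0)}"

context algebra_over
begin

text \<open>The bilinear form \<open>(x, y) \<mapsto> \<phi> (x * y)\<close> is nondegenerate.\<close>

definition frobenius :: bool where
  "frobenius \<longleftrightarrow> (\<exists>\<phi>. Vector_Spaces.linear scale (*) \<phi> \<and>
     (\<forall>x. (\<forall>y. \<phi> (x * y) = 0) \<longrightarrow> x = 0) \<and> (\<forall>y. (\<forall>x. \<phi> (x * y) = 0) \<longrightarrow> y = 0))"

definition left_ideal :: "'h set \<Rightarrow> bool" where
  "left_ideal L \<longleftrightarrow> subspace L \<and> (\<forall>h. \<forall>x\<in>L. h * x \<in> L)"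

text \<open>The left regular module is semisimple: each of its submodules is a direct summand.\<close>

definition semisimple :: bool where
  "semisimple \<longleftrightarrow> (\<forall>L. left_ideal L \<longrightarrow>
     (\<exists>M. left_ideal M \<and> L \<inter> M = {0} \<and> {x + y | x y. x \<in> L \<and> y \<in> M} = UNIV))"

end

text \<open>
  The trace of an endomorphism \<open>f\<close> of a finite-dimensional subspace \<open>V\<close>: the sum of the diagonal
  entries of its matrix in some basis of \<open>V\<close>.  It is only meaningful if \<open>f\<close> is linear and maps
  \<open>V\<close> into itself; then the choice of the basis does not matter.
\<close>

definition (in vector_space) trace_on :: "'b set \<Rightarrow> ('b \<Rightarrow> 'b) \<Rightarrow> 'a" where
  "trace_on V f =
     (let B = (SOME B. B \<subseteq> V \<and> independent B \<and> span B = V)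
      in \<Sum>b\<in>B. representation B (f b) b)"

end

theory Submission
  imports Defs
begin

text \<open>
  Write \<open>\<epsilon>\<^sub>s\<close> for the source map.  Call \<open>r\<close> a right integral if \<open>r h = r \<epsilon>\<^sub>s(h)\<close> for all \<open>h\<close>.  Every
  right integral gives a Casimir element \<open>S(r\<^sub>1) \<otimes> r\<^sub>2\<close> of \<open>H \<otimes> H\<close> (lemma \<open>casimir\<close>): moving a factor
  \<open>h\<close> from the left of the first leg to the right of the second does not change it.  Its product
  \<open>S(r\<^sub>1) r\<^sub>2 = \<epsilon>\<^sub>s(r)\<close> is therefore a central element of \<open>H\<^sub>s\<close>, and if that element is invertible,
  then averaging linear projections onto left ideals proves Maschke's theorem
  (\<open>semisimple_of_integral\<close>).

  A right integral is obtained as a trace.  Let \<open>r\<close> be the element with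
  \[ f(r) = \mathrm{Tr}(x \mapsto f(x_2) S^2(x_1)) \]
  for all linear functionals \<open>f\<close>.  With \<open>F(x) = f(x\<^sub>2) S\<^sup>2(x\<^sub>1)\<close> one has
  \<open>f(x\<^sub>2 h) S\<^sup>2(x\<^sub>1) = F(x h\<^sub>2) S(h\<^sub>1)\<close> (\<open>second_leg_mult_eq_untwisted\<close>), and cyclicity of the trace turns the
  right side into \<open>F(x S(h\<^sub>1) h\<^sub>2) = F(x \<epsilon>\<^sub>s(h))\<close>, whose trace is \<open>f(r \<epsilon>\<^sub>s(h))\<close>; so \<open>r\<close> is a right
  integral (\<open>right_integral_trace_integral\<close>).  Taking \<open>f = \<epsilon>(\<cdot> p)\<close> for a \<open>p\<close> in \<open>H\<^sub>s\<close> gives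
  \[ \epsilon(\varepsilon_s(r) p) = \epsilon(r p) = \mathrm{Tr}(x \mapsto S^2(x p)) , \]
  and for a central idempotent \<open>p\<close> fixed by \<open>S\<^sup>2\<close> the right side is the trace of \<open>S\<^sup>2\<close> on \<open>p H\<close>.

  It remains to see that \<open>z = \<epsilon>\<^sub>s(r)\<close> is invertible.  The algebra \<open>H\<^sub>s \<inter> Z(H)\<close> is von Neumann regular,
  because \<open>1\<^sub>1 \<otimes> \<epsilon>\<^sub>s(1\<^sub>2)\<close> acts as a separability idempotent
  (\<open>central_source_von_neumann_regular\<close>).  If \<open>z\<close> were not invertible, then \<open>z\<close> would thus be
  annihilated by a nonzero idempotent of this algebra, hence by a primitive one \<open>p\<close>, and
  \<open>\<epsilon>(z p) = 0\<close> would contradict the assumption that the trace of \<open>S\<^sup>2\<close> on \<open>p H\<close> is not zero.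
\<close>

section \<open>Tensors and linear maps\<close>

lemma linear_map_lin_ext:
  assumes "Vector_Spaces.linear s s' L"
  shows "L (lin_ext s \<gamma> t) = lin_ext s' (\<lambda>x. L (\<gamma> x)) t"
proof -
  interpret Vector_Spaces.linear s s' L by fact
  show ?thesis by (simp add: lin_ext_def sum scale)
qed

lemma lin_ext_swap:
  assumes "vector_space s"
  shows "lin_ext s (\<lambda>x. lin_ext s (\<beta> x) u) t = lin_ext s (\<lambda>y. lin_ext s (\<lambda>x. \<beta> x y) t) u"
proof -
  interpret vector_space s by fact
  show ?thesis
    by (simp add: lin_ext_def scale_sum_right sum.swap[of _ "Poly_Mapping.keys u"] mult.commute)
qed

lemma lin_ext_cong_teq3:
  fixes scale :: "'k::field \<Rightarrow> 'h::ab_group_add \<Rightarrow> 'h"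
  assumes "vector_space scale" "vector_space s"
    and "\<And>b c. Vector_Spaces.linear scale s (\<lambda>a. \<beta> (a, b, c))"
    and "\<And>a c. Vector_Spaces.linear scale s (\<lambda>b. \<beta> (a, b, c))"
    and "\<And>a b. Vector_Spaces.linear scale s (\<lambda>c. \<beta> (a, b, c))"
    and "teq3 scale t u"
  shows "lin_ext s \<beta> t = lin_ext s \<beta> u"
proof -
  interpret L: Vector_Spaces.linear fscale s "lin_ext s \<beta>" by (rule lin_ext_linear) fact
  interpret A: Vector_Spaces.linear scale s "\<lambda>a. \<beta> (a, b, c)" for b c by fact
  interpret B: Vector_Spaces.linear scale s "\<lambda>b. \<beta> (a, b, c)" for a c by fact
  interpret C: Vector_Spaces.linear scale s "\<lambda>c. \<beta> (a, b, c)" for a b by fact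
  have "lin_ext s \<beta> x = 0" if "x \<in> relations3 scale" for x
    using that unfolding relations3_def
    by (rule L.eq_0_on_span[rotated])
      (auto simp: L.diff L.scale pure3_def lin_ext_single[OF assms(2)]
        A.add B.add C.add A.scale B.scale C.scale)
  from this[of "t - u"] assms(6) show ?thesis by (simp add: teq3_def L.diff)
qed

context weak_hopf_algebra
begin

section \<open>A calculus for Sweedler notation\<close>

text \<open>
  The expression \<open>\<beta>(h\<^sub>1, h\<^sub>2)\<close> of Sweedler notation, for a bilinear map \<open>\<beta>\<close> with values in \<open>H\<close>; iterated
  coproducts are nested applications.  Values in \<open>H\<close> suffice: an identity between scalars is
  expressed by letting them act on an arbitrary vector, and an identity between tensors by
  evaluating both sides under an arbitrary multilinear map.
\<close>
definition sweedler :: "'h \<Rightarrow> ('h \<Rightarrow> 'h \<Rightarrow> 'h) \<Rightarrow> 'h" where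
  "sweedler h \<beta> = lin_ext scale (\<lambda>(a, b). \<beta> a b) (\<Delta> h)"

abbreviation lin :: "('h \<Rightarrow> 'h) \<Rightarrow> bool" where
  "lin \<equiv> Vector_Spaces.linear scale scale"

abbreviation functional :: "('h \<Rightarrow> 'k) \<Rightarrow> bool" where
  "functional \<equiv> Vector_Spaces.linear scale (*)"

definition bilin :: "('h \<Rightarrow> 'h \<Rightarrow> 'h) \<Rightarrow> bool" where
  "bilin \<beta> \<longleftrightarrow> (\<forall>b. lin (\<lambda>a. \<beta> a b)) \<and> (\<forall>a. lin (\<lambda>b. \<beta> a b))"

definition trilin :: "('h \<Rightarrow> 'h \<Rightarrow> 'h \<Rightarrow> 'h) \<Rightarrow> bool" where
  "trilin \<beta> \<longleftrightarrow> (\<forall>b c. lin (\<lambda>a. \<beta> a b c)) \<and> (\<forall>a c. lin (\<lambda>b. \<beta> a b c)) \<and>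
     (\<forall>a b. lin (\<lambda>c. \<beta> a b c))"

lemma vector_space_scale: "vector_space scale" ..
lemma vector_space_field: "vector_space ((*) :: 'k \<Rightarrow> 'k \<Rightarrow> 'k)"
  using counit_linear by (simp add: Vector_Spaces.linear_def)

lemma linI: "(\<And>x y. f (x + y) = f x + f y) \<Longrightarrow> (\<And>r x. f (scale r x) = scale r (f x)) \<Longrightarrow> lin f"
  by unfold_locales auto

lemma linD:
  assumes "lin f"
  shows "f (x + y) = f x + f y" "f (scale r x) = scale r (f x)"
proof -
  interpret Vector_Spaces.linear scale scale f by fact
  show "f (x + y) = f x + f y" "f (scale r x) = scale r (f x)" by (rule add scale)+
qed

lemma functionalD:
  assumes "functional f"
  shows "f (x + y) = f x + f y" "f (scale r x) = r * f x"
proof -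
  interpret Vector_Spaces.linear scale "(*)" f by fact
  show "f (x + y) = f x + f y" "f (scale r x) = r * f x" by (rule add scale)+
qed

lemma bilinI: "(\<And>b. lin (\<lambda>a. \<beta> a b)) \<Longrightarrow> (\<And>a. lin (\<lambda>b. \<beta> a b)) \<Longrightarrow> bilin \<beta>"
  by (simp add: bilin_def)

lemma trilinI: "(\<And>b c. lin (\<lambda>a. \<beta> a b c)) \<Longrightarrow> (\<And>a c. lin (\<lambda>b. \<beta> a b c)) \<Longrightarrow>
   (\<And>a b. lin (\<lambda>c. \<beta> a b c)) \<Longrightarrow> trilin \<beta>"
  by (simp add: trilin_def)

lemma lin_comp: "lin g \<Longrightarrow> lin f \<Longrightarrow> lin (\<lambda>x. g (f x))"
  by (auto intro!: linI simp: linD)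

lemma bilinD:
  assumes "bilin \<beta>" "lin f"
  shows "lin (\<lambda>x. \<beta> (f x) c)" "lin (\<lambda>x. \<beta> c (f x))"
  using assms lin_comp[of "\<lambda>a. \<beta> a c" f] lin_comp[of "\<lambda>a. \<beta> c a" f] by (auto simp: bilin_def)

lemma lin_id: "lin (\<lambda>x. x)" by (rule linI) auto
lemma lin_multl: "lin f \<Longrightarrow> lin (\<lambda>x. c * f x)"
  by (auto intro!: linI simp: linD algebra_simps scale_mult_right)
lemma lin_multr: "lin f \<Longrightarrow> lin (\<lambda>x. f x * c)"
  by (auto intro!: linI simp: linD algebra_simps scale_mult_left)
lemma lin_scale: "lin f \<Longrightarrow> lin (\<lambda>x. scale c (f x))"
  by (auto intro!: linI simp: linD algebra_simps)
lemma lin_functional: "functional \<phi> \<Longrightarrow> lin f \<Longrightarrow> lin (\<lambda>x. scale (\<phi> (f x)) c)"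
  by (auto intro!: linI simp: linD functionalD algebra_simps)
lemma lin_antipode: "lin f \<Longrightarrow> lin (\<lambda>x. S (f x))"
  using antipode_linear by (rule lin_comp)

lemma sweedler_arg_lin: "bilin \<beta> \<Longrightarrow> lin (\<lambda>h. sweedler h \<beta>)"
proof (rule linI)
  assume b: "bilin \<beta>"
  interpret L: Vector_Spaces.linear fscale scale "lin_ext scale (\<lambda>(a, b). \<beta> a b)"
    by (rule lin_ext_linear[OF vector_space_scale])
  note cong = lin_ext_cong_teq2[OF vector_space_scale vector_space_scale, of "\<lambda>(a,b). \<beta> a b"]
  fix x y r
  show "sweedler (x + y) \<beta> = sweedler x \<beta> + sweedler y \<beta>"
    unfolding sweedler_def using b by (subst cong[OF _ _ comult_add]) (auto simp: bilin_def L.add)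
  show "sweedler (scale r x) \<beta> = scale r (sweedler x \<beta>)"
    unfolding sweedler_def using b by (subst cong[OF _ _ comult_scale]) (auto simp: bilin_def L.scale)
qed

lemma sweedler_push: "lin L \<Longrightarrow> L (sweedler h \<beta>) = sweedler h (\<lambda>a b. L (\<beta> a b))"
  by (simp add: sweedler_def linear_map_lin_ext case_prod_unfold)

lemma sweedler_swap:
  "sweedler g (\<lambda>a b. sweedler h (\<beta> a b)) = sweedler h (\<lambda>c d. sweedler g (\<lambda>a b. \<beta> a b c d))"
  using lin_ext_swap[OF vector_space_scale, of "\<lambda>(a,b) (c,d). \<beta> a b c d" "\<Delta> h" "\<Delta> g"]
  by (simp add: sweedler_def case_prod_unfold)

lemma lin_sweedler:
  assumes "\<And>a b. lin (\<lambda>x. \<beta> x a b)"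
  shows "lin (\<lambda>x. sweedler h (\<beta> x))"
  by (rule linI)
    (simp_all add: sweedler_def lin_ext_def linD[OF assms] case_prod_unfold scale_right_distrib
      sum.distrib scale_sum_right mult.commute)

lemma lin_sweedler_arg: "lin f \<Longrightarrow> bilin \<beta> \<Longrightarrow> lin (\<lambda>x. sweedler (f x) \<beta>)"
  by (rule lin_comp[OF sweedler_arg_lin])

lemma sweedler_mem: "subspace V \<Longrightarrow> (\<And>a b. \<beta> a b \<in> V) \<Longrightarrow> sweedler h \<beta> \<in> V"
  by (auto simp: sweedler_def lin_ext_def case_prod_unfold intro!: subspace_sum subspace_scale)

lemma sweedler_const_mult:
  "x * sweedler h \<beta> = sweedler h (\<lambda>a b. x * \<beta> a b)"
  "sweedler h \<beta> * x = sweedler h (\<lambda>a b. \<beta> a b * x)"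
  "scale c (sweedler h \<beta>) = sweedler h (\<lambda>a b. scale c (\<beta> a b))"
  by (rule sweedler_push, intro lin_multl lin_multr lin_scale lin_id)+

lemma source_map_eq: "source_map h = sweedler 1 (\<lambda>a b. scale (\<epsilon> (h * b)) a)"
  by (simp add: source_map_def sweedler_def)
lemma target_map_eq: "target_map h = sweedler 1 (\<lambda>a b. scale (\<epsilon> (a * h)) b)"
  by (simp add: target_map_def sweedler_def)

lemma lin_source: "lin f \<Longrightarrow> lin (\<lambda>x. source_map (f x))"
  unfolding source_map_eq by (intro lin_sweedler lin_functional[OF counit_linear] lin_multr)
lemma lin_target: "lin f \<Longrightarrow> lin (\<lambda>x. target_map (f x))"
  unfolding target_map_eq by (intro lin_sweedler lin_functional[OF counit_linear] lin_multl)

text \<open>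
  The head symbol of an expression and the position of the variable determine the rule that applies,
  so that, as introduction rules, these facts discharge the multilinearity conditions of all
  calculations below.
\<close>
lemmas lin_intros = lin_id lin_multl lin_multr lin_scale lin_functional[OF counit_linear] lin_antipode
  lin_source lin_target lin_sweedler lin_sweedler_arg bilinI trilinI

lemma sweedler_counit: "sweedler h (\<lambda>a b. scale (\<epsilon> a) b) = h" "sweedler h (\<lambda>a b. scale (\<epsilon> b) a) = h"
  using counit_left[of h] counit_right[of h]
  by (simp_all add: sweedler_def counit_left_def counit_right_def)

lemma lin_ext_tmult2:
  "lin_ext scale \<beta> (tmult2 t u) = lin_ext scale (\<lambda>(a,b). lin_ext scale (\<lambda>(c,d). \<beta> (a*c, b*d)) u) t"
  by (simp add: tmult2_def linear_map_lin_ext[OF lin_ext_linear[OF vector_space_scale]] 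
      case_prod_unfold pure2_def lin_ext_single[OF vector_space_scale])

lemma sweedler_mult:
  assumes "bilin \<beta>"
  shows "sweedler (g * h) \<beta> = sweedler g (\<lambda>a b. sweedler h (\<lambda>c d. \<beta> (a * c) (b * d)))"
  unfolding sweedler_def
  using assms lin_ext_cong_teq2[OF vector_space_scale vector_space_scale _ _ comult_mult,
      of "\<lambda>(a,b). \<beta> a b"]
  by (simp add: lin_ext_tmult2 bilin_def)

lemmas lin_ext_comp =
  linear_map_lin_ext[OF lin_ext_linear[OF vector_space_scale]]
  linear_map_lin_ext[OF lin_ext_linear[OF vector_space_fscale]]

lemma lin_ext_comult_left:
  "lin_ext scale (\<lambda>(a, b, c). \<beta> a b c) (comult_left \<Delta> (\<Delta> h)) =
     sweedler h (\<lambda>a b. sweedler a (\<lambda>c d. \<beta> c d b))"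
  by (simp add: comult_left_def sweedler_def lin_ext_comp case_prod_unfold pure3_def
      lin_ext_single[OF vector_space_scale])
lemma lin_ext_comult_right:
  "lin_ext scale (\<lambda>(a, b, c). \<beta> a b c) (comult_right \<Delta> (\<Delta> h)) =
     sweedler h (\<lambda>a b. sweedler b (\<lambda>c d. \<beta> a c d))"
  by (simp add: comult_right_def sweedler_def lin_ext_comp case_prod_unfold pure3_def
      lin_ext_single[OF vector_space_scale])

lemma trilin_cong:
  assumes "trilin \<beta>" "teq3 scale t u"
  shows "lin_ext scale (\<lambda>(a, b, c). \<beta> a b c) t = lin_ext scale (\<lambda>(a, b, c). \<beta> a b c) u"
  by (rule lin_ext_cong_teq3[OF vector_space_scale vector_space_scale _ _ _ assms(2)])
    (use assms(1) in \<open>auto simp: trilin_def\<close>)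

lemma sweedler_coassoc:
  "trilin \<beta> \<Longrightarrow> sweedler h (\<lambda>a b. sweedler a (\<lambda>c d. \<beta> c d b)) = sweedler h (\<lambda>a b. sweedler b (\<beta> a))"
  using trilin_cong[OF _ coassoc] unfolding lin_ext_comult_left lin_ext_comult_right .

text \<open>
  The two axioms for \<open>(\<Delta> \<otimes> id) \<Delta>(1)\<close>.  The middle leg is \<open>1\<^sub>2 1'\<^sub>1\<close> in the first and \<open>1'\<^sub>1 1\<^sub>2\<close> in the
  second one, which is what makes the two bases commute.
\<close>
lemma sweedler_one1:
  assumes "trilin \<beta>"
  shows "sweedler 1 (\<lambda>a b. sweedler a (\<lambda>c d. \<beta> c d b)) =
    sweedler 1 (\<lambda>a b. sweedler 1 (\<lambda>c d. \<beta> a (b * c) d))"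
  using trilin_cong[OF assms comult_one1] unfolding lin_ext_comult_left
  by (simp add: tmult3_def unit_right_def unit_left_def lin_ext_comp
      lin_ext_single[OF vector_space_scale] lin_ext_single[OF vector_space_fscale]
      pure3_def case_prod_unfold sweedler_def)

lemma sweedler_one2:
  assumes "trilin \<beta>"
  shows "sweedler 1 (\<lambda>a b. sweedler a (\<lambda>c d. \<beta> c d b)) =
    sweedler 1 (\<lambda>c d. sweedler 1 (\<lambda>a b. \<beta> a (c * b) d))"
  using trilin_cong[OF assms comult_one2] unfolding lin_ext_comult_left
  by (simp add: tmult3_def unit_right_def unit_left_def lin_ext_comp
      lin_ext_single[OF vector_space_scale] lin_ext_single[OF vector_space_fscale]
      pure3_def case_prod_unfold sweedler_def)

lemma counit_split: "sweedler g (\<lambda>a b. scale (\<epsilon> (f * a)) (scale (\<epsilon> (b * h)) v)) = scale (\<epsilon> (f * g * h)) v"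
proof -
  have "Vector_Spaces.linear (*) scale (\<lambda>c. scale c v)"
    using vector_space_field vector_space_scale by (simp add: Vector_Spaces.linear_iff scale_left_distrib)
  show ?thesis
    by (simp add: linear_map_lin_ext[OF \<open>Vector_Spaces.linear (*) scale (\<lambda>c. scale c v)\<close>]
      counit_mult1 sweedler_def case_prod_unfold)
qed

lemma source_map_antipode: "sweedler h (\<lambda>a b. S a * b) = source_map h"
  unfolding sweedler_def antipode_left
  by (simp add: counit_right_def lin_ext_tmult2 source_map_def case_prod_unfold)
    (simp add: pure2_def lin_ext_single[OF vector_space_scale])

lemma target_map_antipode: "sweedler h (\<lambda>a b. a * S b) = target_map h"
  unfolding sweedler_def antipode_right
  by (simp add: counit_left_def lin_ext_tmult2 target_map_def case_prod_unfold)
    (simp add: pure2_def lin_ext_single[OF vector_space_scale])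

text \<open>
  The counit axiom with middle factor \<open>1\<close> says that \<open>\<epsilon>(x y)\<close> depends on \<open>x\<close> only through \<open>\<epsilon>\<^sub>s(x)\<close>, and
  on \<open>y\<close> only through \<open>\<epsilon>\<^sub>t(y)\<close>.
\<close>
lemma counit_source: "\<epsilon> (source_map x * y) = \<epsilon> (x * y)"
proof -
  have "functional (\<lambda>u. \<epsilon> (u * y))"
    using vector_space_scale vector_space_field counit_linear
    by (simp add: Vector_Spaces.linear_iff algebra_simps scale_mult_left)
  from linear_map_lin_ext[OF this, of "\<lambda>(a, b). scale (\<epsilon> (x * b)) a" "\<Delta> 1"] show ?thesis
    using counit_mult2[of x 1 y] counit_linear
    by (simp add: source_map_def case_prod_unfold scale_mult_left functionalD)
qed

lemma counit_target: "\<epsilon> (x * target_map y) = \<epsilon> (x * y)"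
proof -
  have "functional (\<lambda>u. \<epsilon> (x * u))"
    using vector_space_scale vector_space_field counit_linear
    by (simp add: Vector_Spaces.linear_iff algebra_simps scale_mult_right)
  from linear_map_lin_ext[OF this, of "\<lambda>(a, b). scale (\<epsilon> (a * y)) b" "\<Delta> 1"] show ?thesis
    using counit_mult2[of x 1 y] counit_linear
    by (simp add: target_map_def case_prod_unfold scale_mult_right functionalD mult.commute)
qed

lemma source_map_one [simp]: "source_map 1 = 1" and target_map_one [simp]: "target_map 1 = 1"
  using sweedler_counit[of 1] by (simp_all add: source_map_eq target_map_eq)

section \<open>The source and target bases\<close>

text \<open>
  For \<open>y\<close> in \<open>H\<^sub>s\<close> one has \<open>\<Delta>(y) = 1\<^sub>1 \<otimes> 1\<^sub>2 y = 1\<^sub>1 \<otimes> y 1\<^sub>2\<close>: apply \<open>\<Delta>\<close> to the first leg in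
  \<open>y = 1\<^sub>1 \<epsilon>(h 1\<^sub>2)\<close> and use either axiom for \<open>(\<Delta> \<otimes> id) \<Delta>(1)\<close>.
\<close>
lemma sweedler_source_map:
  assumes "bilin \<beta>"
  shows "sweedler (source_map h) \<beta> = sweedler 1 (\<lambda>a b. \<beta> a (b * source_map h))"
    and "sweedler (source_map h) \<beta> = sweedler 1 (\<lambda>a b. \<beta> a (source_map h * b))"
proof -
  have l: "lin (\<lambda>x. \<beta> a (b * x))" "lin (\<lambda>x. \<beta> a (x * b))" for a b
    by (intro lin_intros bilinD[OF assms])+
  have *: "sweedler (source_map h) \<beta> =
      sweedler 1 (\<lambda>a b. sweedler a (\<lambda>c d. scale (\<epsilon> (h * b)) (\<beta> c d)))"
    unfolding source_map_eq
    by (subst sweedler_push[of "\<lambda>x. sweedler x \<beta>"])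
      (auto intro!: sweedler_arg_lin assms
        simp: linD[OF sweedler_arg_lin[OF assms]] sweedler_const_mult)
  also have "\<dots> = sweedler 1 (\<lambda>a b. sweedler 1 (\<lambda>c d. scale (\<epsilon> (h * d)) (\<beta> a (b * c))))"
    by (rule sweedler_one1) (intro lin_intros bilinD[OF assms])
  also have "\<dots> = sweedler 1 (\<lambda>a b. \<beta> a (b * source_map h))"
    using sweedler_push[OF l(1)] linD(2)[OF l(1)] by (simp add: source_map_eq)
  finally show "sweedler (source_map h) \<beta> = sweedler 1 (\<lambda>a b. \<beta> a (b * source_map h))" .
  note *
  also have "sweedler 1 (\<lambda>a b. sweedler a (\<lambda>c d. scale (\<epsilon> (h * b)) (\<beta> c d))) =
      sweedler 1 (\<lambda>c d. sweedler 1 (\<lambda>a b. scale (\<epsilon> (h * d)) (\<beta> a (c * b))))"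
    by (rule sweedler_one2) (intro lin_intros bilinD[OF assms])
  also have "\<dots> = sweedler 1 (\<lambda>a b. sweedler 1 (\<lambda>c d. scale (\<epsilon> (h * d)) (\<beta> a (c * b))))"
    by (rule sweedler_swap)
  also have "\<dots> = sweedler 1 (\<lambda>a b. \<beta> a (source_map h * b))"
    using sweedler_push[OF l(2)] linD(2)[OF l(2)] by (simp add: source_map_eq)
  finally show "sweedler (source_map h) \<beta> = sweedler 1 (\<lambda>a b. \<beta> a (source_map h * b))" .
qed

text \<open>Consequently elements of \<open>H\<^sub>s\<close> act on the second leg of a coproduct only.\<close>
lemma sweedler_mult_source:
  assumes "bilin \<beta>"
  shows "sweedler (x * source_map h) \<beta> = sweedler x (\<lambda>a b. \<beta> a (b * source_map h))"
proof -
  have "sweedler (x * source_map h) \<beta> =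
      sweedler x (\<lambda>a b. sweedler 1 (\<lambda>c d. \<beta> (a * c) (b * d * source_map h)))"
    by (subst sweedler_mult[OF assms], subst sweedler_source_map(1))
      (intro lin_intros bilinD[OF assms], simp add: mult.assoc)
  also have "\<dots> = sweedler (x * 1) (\<lambda>a b. \<beta> a (b * source_map h))"
    by (subst sweedler_mult) (intro lin_intros bilinD[OF assms] refl)+
  finally show ?thesis by simp
qed

lemma sweedler_source_mult:
  assumes "bilin \<beta>"
  shows "sweedler (source_map h * x) \<beta> = sweedler x (\<lambda>a b. \<beta> a (source_map h * b))"
proof -
  have "sweedler (source_map h * x) \<beta> =
      sweedler 1 (\<lambda>a b. sweedler x (\<lambda>c d. \<beta> (a * c) (source_map h * (b * d))))"
    by (subst sweedler_mult[OF assms], subst sweedler_source_map(2))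
      (intro lin_intros bilinD[OF assms], simp add: mult.assoc)
  also have "\<dots> = sweedler (1 * x) (\<lambda>a b. \<beta> a (source_map h * b))"
    by (subst sweedler_mult) (intro lin_intros bilinD[OF assms] refl)+
  finally show ?thesis by simp
qed

text \<open>Elements of \<open>H\<^sub>t\<close> act on the first leg, by the mirrored calculation.\<close>
lemma sweedler_target_map:
  assumes "bilin \<beta>"
  shows "sweedler (target_map h) \<beta> = sweedler 1 (\<lambda>a b. \<beta> (a * target_map h) b)"
proof -
  have "sweedler (target_map h) \<beta> = sweedler 1 (\<lambda>a b. sweedler b (\<lambda>c d. scale (\<epsilon> (a * h)) (\<beta> c d)))"
    unfolding target_map_eq
    by (subst sweedler_push[of "\<lambda>x. sweedler x \<beta>"])
      (auto intro!: sweedler_arg_lin assms simp: linD[OF sweedler_arg_lin[OF assms]] sweedler_const_mult)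
  also have "\<dots> = sweedler 1 (\<lambda>a b. sweedler a (\<lambda>c d. scale (\<epsilon> (c * h)) (\<beta> d b)))"
    by (rule sweedler_coassoc[symmetric]) (intro lin_intros bilinD[OF assms])
  also have "\<dots> = sweedler 1 (\<lambda>c d. sweedler 1 (\<lambda>a b. scale (\<epsilon> (a * h)) (\<beta> (c * b) d)))"
    by (rule sweedler_one2) (intro lin_intros bilinD[OF assms])
  also have "\<dots> = sweedler 1 (\<lambda>a b. \<beta> (a * target_map h) b)"
  proof -
    have "lin (\<lambda>x. \<beta> (a * x) b)" for a b by (intro lin_intros bilinD[OF assms])
    from sweedler_push[OF this] linD(2)[OF this] show ?thesis
      by (simp add: target_map_eq)
  qed
  finally show ?thesis .
qed

lemma sweedler_mult_target:
  assumes "bilin \<beta>"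
  shows "sweedler (x * target_map h) \<beta> = sweedler x (\<lambda>a b. \<beta> (a * target_map h) b)"
proof -
  have "sweedler (x * target_map h) \<beta> =
      sweedler x (\<lambda>a b. sweedler 1 (\<lambda>c d. \<beta> (a * c * target_map h) (b * d)))"
    by (subst sweedler_mult[OF assms], subst sweedler_target_map)
      (intro lin_intros bilinD[OF assms], simp add: mult.assoc)
  also have "\<dots> = sweedler (x * 1) (\<lambda>a b. \<beta> (a * target_map h) b)"
    by (subst sweedler_mult) (intro lin_intros bilinD[OF assms] refl)+
  finally show ?thesis by simp
qed

text \<open>
  Contracting the outer legs of the two expressions for \<open>(\<Delta> \<otimes> id) \<Delta>(1)\<close> with \<open>\<epsilon>(\<cdot> h)\<close> and \<open>\<epsilon>(g \<cdot>)\<close>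
  yields the two products.
\<close>
lemma source_target_commute: "source_map g * target_map h = target_map h * source_map g"
proof -
  let ?\<beta> = "\<lambda>a x d. scale (\<epsilon> (a * h)) (scale (\<epsilon> (g * d)) x)"
  have t: "trilin ?\<beta>" by (intro lin_intros)
  have "target_map h * source_map g = sweedler 1 (\<lambda>a b. scale (\<epsilon> (a * h)) b * source_map g)"
    by (simp only: target_map_eq sweedler_const_mult(2))
  also have "\<dots> = sweedler 1 (\<lambda>a b. sweedler 1 (\<lambda>c d. ?\<beta> a (b * c) d))"
    by (simp add: source_map_eq sweedler_const_mult scale_mult_left scale_mult_right mult.commute)
  finally have e: "sweedler 1 (\<lambda>a b. sweedler 1 (\<lambda>c d. ?\<beta> a (b * c) d)) = target_map h * source_map g" ..
  have "source_map g * target_map h = sweedler 1 (\<lambda>c d. scale (\<epsilon> (g * d)) c * target_map h)"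
    by (simp only: source_map_eq sweedler_const_mult(2))
  also have "\<dots> = sweedler 1 (\<lambda>c d. sweedler 1 (\<lambda>a b. ?\<beta> a (c * b) d))"
    by (simp add: target_map_eq sweedler_const_mult scale_mult_left scale_mult_right scale_left_commute mult.commute)
  finally show ?thesis using e sweedler_one1[OF t] sweedler_one2[OF t] by simp
qed

lemma source_map_mult_left: "source_map (x * y) = source_map (source_map x * y)"
  by (simp add: source_map_eq[of "_ * _"] mult.assoc counit_source)
lemma target_map_mult_right: "target_map (x * y) = target_map (x * target_map y)"
  using counit_target[of "_ * x" y] by (simp add: target_map_eq[of "_ * _"] mult.assoc)

lemma source_map_mult_source: "source_map (x * source_map y) = source_map x * source_map y"
  unfolding source_map_antipode[symmetric, of "x * _"] source_map_antipode[symmetric, of x]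
  by (subst sweedler_mult_source) (intro lin_intros, simp add: sweedler_const_mult mult.assoc)

lemma source_map_source_mult: "source_map (source_map x * y) = sweedler y (\<lambda>a b. S a * source_map x * b)"
  unfolding source_map_antipode[symmetric, of "_ * y"]
  by (subst sweedler_source_mult) (intro lin_intros, simp flip: mult.assoc)

lemma target_map_mult_target: "target_map (x * target_map y) = sweedler x (\<lambda>a b. a * target_map y * S b)"
  unfolding target_map_antipode[symmetric, of "x * _"]
  by (subst sweedler_mult_target) (intro lin_intros, simp add: mult.assoc)

lemma antipode_source_form: "S h = sweedler h (\<lambda>a b. source_map a * S b)"
  by (subst antipode_antipode) (simp add: lin_ext_comult_left source_map_antipode[symmetric] sweedler_const_mult)

lemma antipode_target_form: "S h = sweedler h (\<lambda>a b. S a * target_map b)"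
proof -
  have "S h = sweedler h (\<lambda>a b. sweedler a (\<lambda>c d. S c * d * S b))"
    by (subst antipode_antipode) (simp add: lin_ext_comult_left)
  also have "\<dots> = sweedler h (\<lambda>a b. sweedler b (\<lambda>c d. S a * c * S d))"
    by (rule sweedler_coassoc) (intro lin_intros)
  finally show ?thesis by (simp add: target_map_antipode[symmetric] sweedler_const_mult mult.assoc)
qed

section \<open>The antipode is antimultiplicative\<close>

text \<open>
  In Sweedler notation, with \<open>\<epsilon>\<^sub>t(g h) = g\<^sub>1 \<epsilon>\<^sub>t(h) S(g\<^sub>2)\<close> and \<open>\<epsilon>\<^sub>s(g h) = S(h\<^sub>1) \<epsilon>\<^sub>s(g) h\<^sub>2\<close>,
  \[ S(gh) = S(g_1h_1)\,\varepsilon_t(g_2h_2) = S(g_1h_1)\, g_2h_2\, S(h_3)S(g_3)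
       = \varepsilon_s(g_1h_1)\, S(h_2)S(g_2) = S(h_1)\,\varepsilon_s(g_1)\,\varepsilon_t(h_2)\, S(g_2) , \]
  and since the bases commute this is \<open>S(h\<^sub>1) \<epsilon>\<^sub>t(h\<^sub>2) \<epsilon>\<^sub>s(g\<^sub>1) S(g\<^sub>2) = S(h) S(g)\<close>.
\<close>
lemma antipode_mult: "S (g * h) = S h * S g"
proof -
  have "S (g * h) = sweedler g (\<lambda>a b. sweedler h (\<lambda>c d. S (a * c) * target_map (b * d)))"
    unfolding antipode_target_form[of "g * h"] by (rule sweedler_mult) (intro lin_intros)
  also have "\<dots> = sweedler g (\<lambda>a b. sweedler h (\<lambda>c d.
      sweedler b (\<lambda>b1 b2. sweedler d (\<lambda>d1 d2. S (a * c) * b1 * d1 * S d2 * S b2))))"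
  proof -
    have "S (a * c) * target_map (b * d) =
        sweedler b (\<lambda>b1 b2. sweedler d (\<lambda>d1 d2. S (a * c) * b1 * d1 * S d2 * S b2))" for a b c d
      by (subst target_map_mult_right, subst target_map_mult_target)
        (simp add: target_map_antipode[symmetric] sweedler_const_mult mult.assoc)
    then show ?thesis by simp
  qed
  also have "\<dots> = sweedler g (\<lambda>a b. sweedler b (\<lambda>b1 b2. sweedler h (\<lambda>c d.
      sweedler d (\<lambda>d1 d2. S (a * c) * b1 * d1 * S d2 * S b2))))"
    by (subst sweedler_swap) (rule refl)
  also have "\<dots> = sweedler g (\<lambda>a b. sweedler b (\<lambda>b1 b2. sweedler h (\<lambda>c d.
      sweedler c (\<lambda>d1 d2. S (a * d1) * b1 * d2 * S d * S b2))))"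
    by (subst sweedler_coassoc[of "\<lambda>c d1 d2. S (_ * c) * _ * d1 * S d2 * S _"]) (intro lin_intros refl)+
  also have "\<dots> = sweedler g (\<lambda>a b. sweedler a (\<lambda>a1 a2. sweedler h (\<lambda>c d.
      sweedler c (\<lambda>c1 c2. S (a1 * c1) * a2 * c2 * S d * S b))))"
    by (rule sweedler_coassoc[symmetric]) (intro lin_intros)
  also have "\<dots> = sweedler g (\<lambda>a b. sweedler h (\<lambda>c d. sweedler a (\<lambda>a1 a2.
      sweedler c (\<lambda>c1 c2. S (a1 * c1) * (a2 * c2))) * S d * S b))"
    by (subst sweedler_swap) (simp add: sweedler_const_mult mult.assoc)
  also have "\<dots> = sweedler g (\<lambda>a b. sweedler h (\<lambda>c d. source_map (a * c) * S d * S b))"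
  proof -
    have "sweedler a (\<lambda>a1 a2. sweedler c (\<lambda>c1 c2. S (a1 * c1) * (a2 * c2))) = source_map (a * c)" for a c
      unfolding source_map_antipode[symmetric, of "a * c"] by (rule sweedler_mult[symmetric]) (intro lin_intros)
    then show ?thesis by simp
  qed
  also have "\<dots> = sweedler g (\<lambda>a b. sweedler h (\<lambda>c d.
      sweedler c (\<lambda>c1 c2. S c1 * source_map a * c2 * S d * S b)))"
    by (subst source_map_mult_left, subst source_map_source_mult) (simp add: sweedler_const_mult)
  also have "\<dots> = sweedler g (\<lambda>a b. sweedler h (\<lambda>c d.
      sweedler d (\<lambda>d1 d2. S c * source_map a * d1 * S d2 * S b)))"
    by (subst sweedler_coassoc[of "\<lambda>c1 c2 d. S c1 * source_map _ * c2 * S d * S _"]) (intro lin_intros refl)+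
  also have "\<dots> = sweedler g (\<lambda>a b. sweedler h (\<lambda>c d. (S c * target_map d) * (source_map a * S b)))"
  proof -
    have "sweedler d (\<lambda>d1 d2. S c * source_map a * d1 * S d2 * S b) =
        (S c * target_map d) * (source_map a * S b)" for a b c d
    proof -
      have "sweedler d (\<lambda>d1 d2. S c * source_map a * d1 * S d2 * S b) =
          S c * (source_map a * target_map d) * S b"
        by (simp add: target_map_antipode[symmetric] sweedler_const_mult mult.assoc)
      then show ?thesis by (simp add: source_target_commute mult.assoc)
    qed
    then show ?thesis by simp
  qed
  also have "\<dots> = S h * S g"
    by (subst (2) antipode_source_form, subst antipode_target_form) (simp add: sweedler_const_mult)
  finally show ?thesis .
qed

section \<open>Source and target maps on a leg of a coproduct\<close>

text \<open>
  Insert the counit into \<open>1\<^sub>2 h\<close> on the right side: it becomes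
  \<open>\<epsilon>(x 1\<^sub>1) \<epsilon>(1\<^sub>2 1'\<^sub>1 h\<^sub>1) 1'\<^sub>2 h\<^sub>2 = \<epsilon>(x 1'\<^sub>1 h\<^sub>1) 1'\<^sub>2 h\<^sub>2\<close>, and \<open>\<Delta>(1) \<Delta>(h) = \<Delta>(h)\<close>.
\<close>
lemma counit_first_leg:
  "sweedler h (\<lambda>a b. scale (\<epsilon> (x * a)) b) = sweedler 1 (\<lambda>a b. scale (\<epsilon> (x * a)) (b * h))"
proof -
  have "sweedler 1 (\<lambda>a b. scale (\<epsilon> (x * a)) (b * h)) =
      sweedler 1 (\<lambda>a b. scale (\<epsilon> (x * a)) (sweedler (b * h) (\<lambda>c d. scale (\<epsilon> c) d)))"
    by (simp add: sweedler_counit)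
  also have "\<dots> = sweedler 1 (\<lambda>a b. sweedler b (\<lambda>c d. sweedler h (\<lambda>u v.
      scale (\<epsilon> (x * a)) (scale (\<epsilon> (c * u)) (d * v)))))"
    by (subst sweedler_mult) (intro lin_intros, simp add: sweedler_const_mult)
  also have "\<dots> = sweedler 1 (\<lambda>a b. sweedler a (\<lambda>c d. sweedler h (\<lambda>u v.
      scale (\<epsilon> (x * c)) (scale (\<epsilon> (d * u)) (b * v)))))"
    by (rule sweedler_coassoc[symmetric]) (intro lin_intros)
  also have "\<dots> = sweedler 1 (\<lambda>a b. sweedler 1 (\<lambda>c d. sweedler h (\<lambda>u v.
      scale (\<epsilon> (x * a)) (scale (\<epsilon> (b * (c * u))) (d * v)))))"
    by (subst sweedler_one1) (intro lin_intros, simp add: mult.assoc)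
  also have "\<dots> = sweedler 1 (\<lambda>a b. sweedler (1 * h) (\<lambda>c d.
      scale (\<epsilon> (x * a)) (scale (\<epsilon> (b * c)) d)))"
    by (subst sweedler_mult) (intro lin_intros refl)+
  also have "\<dots> = sweedler h (\<lambda>c d. sweedler 1 (\<lambda>a b. scale (\<epsilon> (x * a)) (scale (\<epsilon> (b * c)) d)))"
    by (subst sweedler_swap) simp
  finally show ?thesis by (simp only: counit_split mult_1_right)
qed

lemma counit_second_leg:
  "sweedler h (\<lambda>a b. scale (\<epsilon> (b * x)) a) = sweedler 1 (\<lambda>a b. scale (\<epsilon> (b * x)) (h * a))"
proof -
  have "sweedler 1 (\<lambda>a b. scale (\<epsilon> (b * x)) (h * a)) =
      sweedler 1 (\<lambda>a b. scale (\<epsilon> (b * x)) (sweedler (h * a) (\<lambda>c d. scale (\<epsilon> d) c)))"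
    by (simp add: sweedler_counit)
  also have "\<dots> = sweedler 1 (\<lambda>a b. sweedler a (\<lambda>c d. sweedler h (\<lambda>u v.
      scale (\<epsilon> (v * d)) (scale (\<epsilon> (b * x)) (u * c)))))"
    by (subst sweedler_mult) (intro lin_intros, subst sweedler_swap,
       simp add: sweedler_const_mult mult.commute)
  also have "\<dots> = sweedler 1 (\<lambda>a b. sweedler 1 (\<lambda>c d. sweedler h (\<lambda>u v.
      scale (\<epsilon> (v * (b * c))) (scale (\<epsilon> (d * x)) (u * a)))))"
    by (rule sweedler_one1) (intro lin_intros)
  also have "\<dots> = sweedler 1 (\<lambda>a b. sweedler h (\<lambda>u v. sweedler 1 (\<lambda>c d.
      scale (\<epsilon> (v * b * c)) (scale (\<epsilon> (d * x)) (u * a)))))"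
    by (subst sweedler_swap) (simp add: mult.assoc)
  also have "\<dots> = sweedler h (\<lambda>u v. sweedler 1 (\<lambda>a b. scale (\<epsilon> (v * b * x)) (u * a)))"
    by (subst sweedler_swap) (simp only: counit_split mult_1_right)
  also have "\<dots> = sweedler (h * 1) (\<lambda>a b. scale (\<epsilon> (b * x)) a)"
    by (subst sweedler_mult) (intro lin_intros refl)+
  finally show ?thesis by simp
qed

text \<open>
  The identity \<open>\<epsilon>\<^sub>t(h\<^sub>1) \<otimes> h\<^sub>2 = \<epsilon>\<^sub>t(1\<^sub>1) \<otimes> 1\<^sub>2 h\<close>, obtained by expanding \<open>\<epsilon>\<^sub>t\<close> and applying
  \<open>counit_first_leg\<close>; \<open>source_map_second_leg\<close> is its mirror image.
\<close>
lemma target_map_first_leg: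
  assumes "bilin \<beta>"
  shows "sweedler h (\<lambda>a b. \<beta> (target_map a) b) = sweedler 1 (\<lambda>a b. \<beta> (target_map a) (b * h))"
proof -
  have l: "lin (\<lambda>x. \<beta> x b)" "lin (\<lambda>x. \<beta> a x)" for a b
    by (intro lin_intros bilinD[OF assms])+
  have e: "\<beta> (target_map a) y = sweedler 1 (\<lambda>c d. \<beta> d (scale (\<epsilon> (c * a)) y))" for a y
    using sweedler_push[OF l(1)] by (simp add: target_map_eq linD[OF l(1)] linD[OF l(2)])
  have "sweedler h (\<lambda>a b. \<beta> (target_map a) b) =
      sweedler 1 (\<lambda>c d. \<beta> d (sweedler h (\<lambda>a b. scale (\<epsilon> (c * a)) b)))"
    unfolding e by (subst sweedler_swap) (simp add: sweedler_push[OF l(2)])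
  also have "\<dots> = sweedler 1 (\<lambda>c d. \<beta> d (sweedler 1 (\<lambda>a b. scale (\<epsilon> (c * a)) (b * h))))"
    by (simp only: counit_first_leg[of h])
  also have "\<dots> = sweedler 1 (\<lambda>c d. sweedler 1 (\<lambda>a b. \<beta> d (scale (\<epsilon> (c * a)) (b * h))))"
    by (simp only: sweedler_push[OF l(2)])
  also have "\<dots> = sweedler 1 (\<lambda>a b. \<beta> (target_map a) (b * h))"
    unfolding e by (rule sweedler_swap)
  finally show ?thesis .
qed

lemma source_map_second_leg:
  assumes "bilin \<beta>"
  shows "sweedler h (\<lambda>a b. \<beta> a (source_map b)) = sweedler 1 (\<lambda>a b. \<beta> (h * a) (source_map b))"
proof -
  have l: "lin (\<lambda>x. \<beta> x b)" "lin (\<lambda>x. \<beta> a x)" for a b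
    by (intro lin_intros bilinD[OF assms])+
  have e: "\<beta> y (source_map b) = sweedler 1 (\<lambda>c d. \<beta> (scale (\<epsilon> (b * d)) y) c)" for b y
    using sweedler_push[OF l(2)] by (simp add: source_map_eq linD[OF l(1)] linD[OF l(2)])
  have "sweedler h (\<lambda>a b. \<beta> a (source_map b)) =
      sweedler 1 (\<lambda>c d. \<beta> (sweedler h (\<lambda>a b. scale (\<epsilon> (b * d)) a)) c)"
    unfolding e by (subst sweedler_swap) (simp add: sweedler_push[OF l(1)])
  also have "\<dots> = sweedler 1 (\<lambda>c d. \<beta> (sweedler 1 (\<lambda>a b. scale (\<epsilon> (b * d)) (h * a))) c)"
    by (simp only: counit_second_leg[of h])
  also have "\<dots> = sweedler 1 (\<lambda>c d. sweedler 1 (\<lambda>a b. \<beta> (scale (\<epsilon> (b * d)) (h * a)) c))"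
    by (simp only: sweedler_push[OF l(1)])
  also have "\<dots> = sweedler 1 (\<lambda>a b. \<beta> (h * a) (source_map b))"
    unfolding e by (rule sweedler_swap)
  finally show ?thesis .
qed

lemma source_map_first_leg_one:
  assumes "bilin \<beta>"
  shows "sweedler 1 (\<lambda>a b. \<beta> (source_map a) b) = sweedler 1 \<beta>"
proof -
  have l: "lin (\<lambda>x. \<beta> x b)" "lin (\<lambda>x. \<beta> a x)" for a b
    by (intro lin_intros bilinD[OF assms])+
  have "sweedler 1 (\<lambda>a b. \<beta> (source_map a) b) =
      sweedler 1 (\<lambda>c d. sweedler 1 (\<lambda>a b. scale (\<epsilon> (c * b)) (\<beta> a d)))"
    using sweedler_push[OF l(1)] by (simp add: source_map_eq linD[OF l(1)] linD[OF l(2)])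
  also have "\<dots> = sweedler 1 (\<lambda>a b. sweedler a (\<lambda>c d. scale (\<epsilon> d) (\<beta> c b)))"
    by (rule sweedler_one2[symmetric]) (intro lin_intros bilinD[OF assms])
  also have "\<dots> = sweedler 1 (\<lambda>a b. \<beta> (sweedler a (\<lambda>c d. scale (\<epsilon> d) c)) b)"
    by (simp add: sweedler_push[OF l(1)] linD[OF l(1)])
  finally show ?thesis by (simp add: sweedler_counit)
qed

text \<open>
  The first leg of \<open>\<Delta>(1)\<close> lies in \<open>H\<^sub>s\<close>, where the antipode agrees with \<open>\<epsilon>\<^sub>t\<close>.  In
  \<open>S(1\<^sub>1) = \<epsilon>\<^sub>s(1\<^sub>1) S(1\<^sub>2)\<close>, with the third leg kept, the factor \<open>\<epsilon>\<^sub>s\<close> can be dropped because the first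
  leg is in \<open>H\<^sub>s\<close>; what remains is \<open>1\<^sub>1 S(1\<^sub>2) \<otimes> 1\<^sub>3 = \<epsilon>\<^sub>t(1\<^sub>1) \<otimes> 1\<^sub>2\<close>.
\<close>
lemma antipode_eq_target_map_first_leg:
  assumes "bilin \<beta>"
  shows "sweedler 1 (\<lambda>a b. \<beta> (S a) b) = sweedler 1 (\<lambda>a b. \<beta> (target_map a) b)"
proof -
  have l: "lin (\<lambda>x. \<beta> x b)" "lin (\<lambda>x. \<beta> a x)" for a b
    by (intro lin_intros bilinD[OF assms])+
  have "sweedler 1 (\<lambda>a b. \<beta> (S a) b) = sweedler 1 (\<lambda>a b. sweedler a (\<lambda>c d. \<beta> (source_map c * S d) b))"
    by (simp only: sweedler_push[OF l(1), symmetric] antipode_source_form[symmetric])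
  also have "\<dots> = sweedler 1 (\<lambda>a b. sweedler 1 (\<lambda>c d. \<beta> (source_map a * S (b * c)) d))"
    by (rule sweedler_one1) (intro lin_intros bilinD[OF assms])
  also have "\<dots> = sweedler 1 (\<lambda>a b. sweedler 1 (\<lambda>c d. \<beta> (a * S (b * c)) d))"
    by (rule source_map_first_leg_one) (intro lin_intros bilinD[OF assms])
  also have "\<dots> = sweedler 1 (\<lambda>a b. sweedler a (\<lambda>c d. \<beta> (c * S d) b))"
    by (rule sweedler_one1[symmetric]) (intro lin_intros bilinD[OF assms])
  finally show ?thesis by (simp only: sweedler_push[OF l(1), symmetric] target_map_antipode)
qed

lemma target_map_first_leg_antipode:
  assumes "bilin \<beta>"
  shows "sweedler h (\<lambda>a b. \<beta> (target_map a) b) = sweedler 1 (\<lambda>a b. \<beta> (S a) (b * h))"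
  by (subst target_map_first_leg[OF assms], subst antipode_eq_target_map_first_leg)
    (intro lin_intros bilinD[OF assms] refl)+

section \<open>Integrals, Casimir elements and semisimplicity\<close>

definition right_integral :: "'h \<Rightarrow> bool" where
  "right_integral r \<longleftrightarrow> (\<forall>h. r * h = r * source_map h)"

text \<open>
  Both sides equal \<open>h\<^sub>1 S(r\<^sub>1 h\<^sub>2) \<otimes> r\<^sub>2 h\<^sub>3\<close>.  For any \<open>r\<close> this is \<open>S(r\<^sub>1) \<otimes> r\<^sub>2 h\<close>, because
  \<open>h\<^sub>1 S(h\<^sub>2) \<otimes> h\<^sub>3 = \<epsilon>\<^sub>t(h\<^sub>1) \<otimes> h\<^sub>2 = S(1\<^sub>1) \<otimes> 1\<^sub>2 h\<close>.  For an integral the tensor \<open>h\<^sub>1 \<otimes> r h\<^sub>2\<close> from which it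
  is formed equals \<open>h\<^sub>1 \<otimes> r \<epsilon>\<^sub>s(h\<^sub>2) = h 1\<^sub>1 \<otimes> r \<epsilon>\<^sub>s(1\<^sub>2)\<close>, so that \<open>h\<close> can be taken out on the left, which
  leaves the case \<open>h = 1\<close>.
\<close>
lemma casimir:
  assumes "right_integral r" "bilin \<beta>"
  shows "sweedler r (\<lambda>a b. \<beta> (h * S a) b) = sweedler r (\<lambda>a b. \<beta> (S a) (b * h))"
proof -
  \<comment> \<open>\<open>h\<^sub>1 S(r\<^sub>1 h\<^sub>2) \<otimes> r\<^sub>2 h\<^sub>3 = S(r\<^sub>1) \<otimes> r\<^sub>2 h\<close>, needed for \<open>\<beta>\<close> and for \<open>\<beta> (h * _)\<close>\<close>
  have *: "sweedler h (\<lambda>h1 h2. sweedler (r * h2) (\<lambda>x y. \<gamma> (h1 * S x) y)) = sweedler r (\<lambda>a b. \<gamma> (S a) (b * h))"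
    if "bilin \<gamma>" for \<gamma> h
  proof -
    have "sweedler h (\<lambda>h1 h2. sweedler (r * h2) (\<lambda>x y. \<gamma> (h1 * S x) y)) =
       sweedler h (\<lambda>h1 h2. sweedler r (\<lambda>a b. sweedler h2 (\<lambda>c d. \<gamma> (h1 * S c * S a) (b * d))))"
      by (subst sweedler_mult) (intro lin_intros bilinD[OF that], simp add: antipode_mult mult.assoc)
    also have "\<dots> = sweedler r (\<lambda>a b. sweedler h (\<lambda>h1 h2. sweedler h2 (\<lambda>c d. \<gamma> (h1 * S c * S a) (b * d))))"
      by (rule sweedler_swap)
    also have "\<dots> = sweedler r (\<lambda>a b. sweedler h (\<lambda>k d. sweedler k (\<lambda>h1 c. \<gamma> (h1 * S c * S a) (b * d))))"
      by (subst sweedler_coassoc) (intro lin_intros bilinD[OF that] refl)+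
    also have "\<dots> = sweedler r (\<lambda>a b. sweedler h (\<lambda>k d. \<gamma> (target_map k * S a) (b * d)))"
    proof -
      have l: "lin (\<lambda>x. \<gamma> (x * S a) b)" for a b by (intro lin_intros bilinD[OF that])
      show ?thesis by (simp only: sweedler_push[OF l, symmetric] target_map_antipode)
    qed
    also have "\<dots> = sweedler r (\<lambda>a b. sweedler 1 (\<lambda>k d. \<gamma> (S (a * k)) (b * d * h)))"
      by (subst target_map_first_leg_antipode) (intro lin_intros bilinD[OF that], simp add: antipode_mult mult.assoc)
    also have "\<dots> = sweedler (r * 1) (\<lambda>a b. \<gamma> (S a) (b * h))"
      by (subst sweedler_mult) (intro lin_intros bilinD[OF that] refl)+
    finally show ?thesis by simp
  qed
  have r: "r * h = r * source_map h" for h using assms(1) by (simp add: right_integral_def)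
  have "sweedler r (\<lambda>a b. \<beta> (S a) (b * h)) =
      sweedler h (\<lambda>h1 h2. sweedler (r * source_map h2) (\<lambda>x y. \<beta> (h1 * S x) y))"
    using *[OF assms(2), of h] by (simp only: r[symmetric])
  also have "\<dots> = sweedler 1 (\<lambda>h1 h2. sweedler (r * source_map h2) (\<lambda>x y. \<beta> (h * h1 * S x) y))"
    by (rule source_map_second_leg) (intro lin_intros bilinD[OF assms(2)])
  \<comment> \<open>for the map \<open>\<lambda>x y. \<beta> (h * x) y\<close> this is the left side of \<open>*\<close> with the unit in place of \<open>h\<close>\<close>
  also have "\<dots> = sweedler 1 (\<lambda>h1 h2. sweedler (r * h2) (\<lambda>x y. \<beta> (h * (h1 * S x)) y))"
    by (simp only: r[symmetric] mult.assoc)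
  also have "\<dots> = sweedler r (\<lambda>a b. \<beta> (h * S a) (b * 1))"
    by (rule *) (intro lin_intros bilinD[OF assms(2)])
  finally show ?thesis by simp
qed

lemma integral_source_central:
  assumes "right_integral r"
  shows "h * source_map r = source_map r * h"
proof -
  have "bilin (\<lambda>a b. a * b)" by (intro lin_intros)
  from casimir[OF assms this, of h] show ?thesis
    by (simp add: source_map_antipode[symmetric] sweedler_const_mult mult.assoc)
qed

text \<open>
  The sum on the right is \<open>f(x\<^sub>2 h\<^sub>3) S\<^sup>2(x\<^sub>1) S(h\<^sub>1 S(h\<^sub>2))\<close>, in which \<open>h\<^sub>1 S(h\<^sub>2) \<otimes> h\<^sub>3\<close> becomes
  \<open>S(1\<^sub>1) \<otimes> 1\<^sub>2 h\<close>; the legs of \<open>\<Delta>(1)\<close> are then absorbed by \<open>\<Delta>(x) \<Delta>(1) = \<Delta>(x)\<close>.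
\<close>
lemma second_leg_mult_eq_untwisted:
  assumes "functional f"
  shows "sweedler x (\<lambda>a b. scale (f (b * h)) (S (S a))) =
     sweedler h (\<lambda>h1 h2. sweedler (x * h2) (\<lambda>a b. scale (f b) (S (S a))) * S h1)"
proof -
  note I = lin_intros lin_functional[OF assms]
  have "sweedler h (\<lambda>h1 h2. sweedler (x * h2) (\<lambda>a b. scale (f b) (S (S a))) * S h1) =
     sweedler h (\<lambda>h1 h2. sweedler x (\<lambda>a b. sweedler h2 (\<lambda>c d. scale (f (b * d)) (S (S a) * S (h1 * S c)))))"
    by (subst sweedler_mult) (intro I, simp add: sweedler_const_mult antipode_mult mult.assoc scale_mult_left)
  also have "\<dots> = sweedler x (\<lambda>a b. sweedler h (\<lambda>h1 h2. sweedler h2 (\<lambda>c d. scale (f (b * d)) (S (S a) * S (h1 * S c)))))"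
    by (rule sweedler_swap)
  also have "\<dots> = sweedler x (\<lambda>a b. sweedler h (\<lambda>k d. sweedler k (\<lambda>h1 c. scale (f (b * d)) (S (S a) * S (h1 * S c)))))"
    by (subst sweedler_coassoc) (intro I refl)+
  also have "\<dots> = sweedler x (\<lambda>a b. sweedler h (\<lambda>k d. scale (f (b * d)) (S (S a) * S (target_map k))))"
  proof -
    have l: "lin (\<lambda>k. scale (f (b * d)) (S (S a) * S k))" for a b d by (intro I)
    show ?thesis by (simp only: sweedler_push[OF l, symmetric] target_map_antipode)
  qed
  also have "\<dots> = sweedler x (\<lambda>a b. sweedler 1 (\<lambda>k d. scale (f (b * d * h)) (S (S (a * k)))))"
    by (subst target_map_first_leg_antipode) (intro I, simp add: antipode_mult mult.assoc)
  also have "\<dots> = sweedler (x * 1) (\<lambda>a b. scale (f (b * h)) (S (S a)))"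
    by (subst sweedler_mult) (intro I refl)+
  finally show ?thesis by simp
qed

text \<open>
  One of the two properties of the separability idempotent \<open>1\<^sub>1 \<otimes> \<epsilon>\<^sub>s(1\<^sub>2)\<close> of \<open>H\<^sub>s\<close>:
  \<open>1\<^sub>1 S(1\<^sub>2) 1\<^sub>3 = \<epsilon>\<^sub>t(1\<^sub>1) 1\<^sub>2 = S(1\<^sub>1) 1\<^sub>2 = \<epsilon>\<^sub>s(1)\<close>.
\<close>
lemma source_separability: "sweedler 1 (\<lambda>a b. a * source_map b) = 1"
proof -
  have "sweedler 1 (\<lambda>a b. a * source_map b) = sweedler 1 (\<lambda>a b. sweedler b (\<lambda>c d. a * S c * d))"
    by (simp add: source_map_antipode[symmetric] sweedler_const_mult mult.assoc)
  also have "\<dots> = sweedler 1 (\<lambda>a b. sweedler a (\<lambda>c d. c * S d * b))"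
    by (rule sweedler_coassoc[symmetric]) (intro lin_intros)
  also have "\<dots> = sweedler 1 (\<lambda>a b. target_map a * b)"
    by (simp add: target_map_antipode[symmetric] sweedler_const_mult)
  also have "\<dots> = sweedler 1 (\<lambda>a b. S a * (b * 1))"
    by (rule target_map_first_leg_antipode) (intro lin_intros)
  finally show ?thesis by (simp add: source_map_antipode)
qed

lemma linear_projection:
  assumes "subspace V"
  obtains P where "lin P" "\<And>x. P x \<in> V" "\<And>x. x \<in> V \<Longrightarrow> P x = x"
proof -
  interpret vector_space_pair scale scale ..
  have "lin (\<lambda>x. x)" by (rule lin_id)
  from linear_exists_left_inverse_on[OF this assms] that show ?thesis
    by (force simp: inj_on_def image_subset_iff)
qed

text \<open>
  Let \<open>P\<close> be a linear projection onto \<open>z H\<close>, and average it to \<open>Q(x) = 1\<^sub>1 P(\<epsilon>\<^sub>s(1\<^sub>2) x)\<close>.  Then \<open>Q\<close> fixes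
  \<open>z\<close>, and \<open>Q(z) = z Q(1)\<close> because \<open>z\<close> can be moved from one leg of the separability idempotent to
  the other.  As \<open>Q(1)\<close> lies in \<open>z H\<close>, this gives \<open>z \<in> z\<^sup>2 H\<close>.
\<close>
lemma central_source_divisible_by_square:
  assumes "source_map z = z" "\<And>h. z * h = h * z"
  obtains v where "z = z * z * v"
proof -
  let ?V = "(\<lambda>h. z * h) ` UNIV"
  have V: "subspace ?V"
  proof (rule subspaceI)
    show "0 \<in> ?V" by (rule image_eqI[of _ _ 0]) simp_all
    show "x + y \<in> ?V" if "x \<in> ?V" "y \<in> ?V" for x y
      using that by (auto simp flip: distrib_left)
    show "scale c x \<in> ?V" if "x \<in> ?V" for c x
      using that by (auto simp flip: scale_mult_right)
  qed
  obtain P where P: "lin P" "\<And>x. P x \<in> ?V" "\<And>x. x \<in> ?V \<Longrightarrow> P x = x"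
    using linear_projection[OF V] by blast
  have b: "bilin (\<lambda>a b. a * P b)" by (intro lin_intros lin_comp[OF P(1)])
  have sz: "source_map (b * z) = source_map b * z" for b
    using source_map_mult_source[of b z] by (simp only: assms(1))
  have Pz: "P (source_map b * z) = source_map b * z" for b
    by (rule P(3)) (simp flip: assms(2))
  have "z = sweedler 1 (\<lambda>a b. a * source_map b) * z" by (simp add: source_separability)
  also have "\<dots> = sweedler 1 (\<lambda>a b. a * P (source_map b * z))"
    by (simp add: sweedler_const_mult Pz mult.assoc)
  also have "\<dots> = sweedler 1 (\<lambda>a b. a * P (source_map (b * z)))"
    by (simp only: sz)
  also have "\<dots> = sweedler z (\<lambda>a b. a * P (source_map b))"
  proof -
    have "bilin (\<lambda>a b. a * P (source_map b))" by (intro lin_intros lin_comp[OF P(1)])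
    from sweedler_source_map(1)[OF this, of z] show ?thesis by (simp only: assms(1))
  qed
  also have "\<dots> = sweedler 1 (\<lambda>a b. z * a * P (source_map b))"
    by (rule source_map_second_leg[OF b])
  also have "\<dots> = z * sweedler 1 (\<lambda>a b. a * P (source_map b))"
    by (simp add: sweedler_const_mult mult.assoc)
  finally have 1: "z = z * sweedler 1 (\<lambda>a b. a * P (source_map b))" .
  have "sweedler 1 (\<lambda>a b. a * P (source_map b)) \<in> ?V"
  proof (rule sweedler_mem[OF V])
    fix a b obtain h where "P (source_map b) = z * h" using P(2) by blast
    then have "a * P (source_map b) = z * (a * h)"
      using assms(2)[of a] by (simp flip: mult.assoc)
    then show "a * P (source_map b) \<in> ?V" by blast
  qed
  then obtain v where "sweedler 1 (\<lambda>a b. a * P (source_map b)) = z * v" by blast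
  with 1 have "z = z * z * v" by (simp only: mult.assoc)
  then show ?thesis by (rule that)
qed

text \<open>
  Maschke's theorem: \<open>Q(x) = u S(r\<^sub>1) P(r\<^sub>2 x)\<close> is \<open>H\<close>-linear by the Casimir property and still a
  projection onto the left ideal, so its kernel is a complement.
\<close>
lemma semisimple_of_integral:
  assumes r: "right_integral r" and u: "source_map r * u = 1" "\<And>h. u * h = h * u"
  shows semisimple
  unfolding semisimple_def
proof (intro allI impI)
  fix L assume L: "left_ideal L"
  then have sL: "subspace L" and mL: "\<And>h x. x \<in> L \<Longrightarrow> h * x \<in> L" by (auto simp: left_ideal_def)
  obtain P where P: "lin P" "\<And>x. P x \<in> L" "\<And>x. x \<in> L \<Longrightarrow> P x = x"
    using linear_projection[OF sL] by blast
  define Q where "Q x = u * sweedler r (\<lambda>a b. S a * P (b * x))" for x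
  have lQ: "lin Q" unfolding Q_def by (intro lin_intros lin_comp[OF P(1)])
  have QL: "Q x \<in> L" for x
    unfolding Q_def by (intro mL sweedler_mem[OF sL] P(2))
  have Qid: "Q x = x" if "x \<in> L" for x
  proof -
    have "Q x = u * (source_map r * x)"
      using that by (simp add: Q_def P(3) mL source_map_antipode[symmetric] sweedler_const_mult mult.assoc)
    then show ?thesis using u by (simp flip: mult.assoc)
  qed
  have Qm: "Q (h * x) = h * Q x" for h x
  proof -
    have "bilin (\<lambda>a b. a * P (b * x))" by (intro lin_intros lin_comp[OF P(1)])
    from casimir[OF r this, of h]
    have "sweedler r (\<lambda>a b. S a * P (b * (h * x))) = h * sweedler r (\<lambda>a b. S a * P (b * x))"
      by (simp add: sweedler_const_mult mult.assoc)
    then show ?thesis using u(2)[of h] unfolding Q_def by (simp flip: mult.assoc)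
  qed
  interpret Q: Vector_Spaces.linear scale scale Q by (rule lQ)
  let ?M = "{x. Q x = 0}"
  have "left_ideal ?M"
    unfolding left_ideal_def by (auto intro!: subspaceI simp: Q.add Q.scale Q.zero Qm)
  moreover have "L \<inter> ?M = {0}"
    using Qid subspace_0[OF sL] by (auto simp: Q.zero)
  moreover have "{x + y | x y. x \<in> L \<and> y \<in> ?M} = UNIV"
  proof -
    have "\<exists>x y. w = x + y \<and> x \<in> L \<and> Q y = 0" for w
      by (rule exI[of _ "Q w"], rule exI[of _ "w - Q w"]) (simp add: QL Qid Q.diff)
    then show ?thesis by auto
  qed
  ultimately show "\<exists>M. left_ideal M \<and> L \<inter> M = {0} \<and> {x + y | x y. x \<in> L \<and> y \<in> M} = UNIV"
    by blast
qed

end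

section \<open>Traces\<close>

context finite_dimensional_vector_space
begin

definition full_trace :: "('b \<Rightarrow> 'b) \<Rightarrow> 'a" where
  "full_trace f = (\<Sum>b\<in>Basis. representation Basis (f b) b)"

lemma functional_representation: "Vector_Spaces.linear scale (*) (\<lambda>x. representation Basis x b)"
  by (rule linear_representation[OF independent_Basis span_Basis])

lemma functional_expand:
  assumes "Vector_Spaces.linear scale (*) \<phi>"
  shows "\<phi> x = (\<Sum>b\<in>Basis. representation Basis x b * \<phi> b)"
proof -
  interpret Vector_Spaces.linear scale "(*)" \<phi> by fact
  have "\<phi> x = \<phi> (\<Sum>b\<in>Basis. scale (representation Basis x b) b)"
    by (subst sum_representation_eq[OF independent_Basis]) (simp_all add: span_Basis finite_Basis)
  also have "\<dots> = (\<Sum>b\<in>Basis. representation Basis x b * \<phi> b)" by (simp add: sum scale)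
  finally show ?thesis .
qed

lemma full_trace_comp:
  assumes "Vector_Spaces.linear scale scale f" "Vector_Spaces.linear scale scale g"
  shows "full_trace (\<lambda>x. f (g x)) = full_trace (\<lambda>x. g (f x))"
proof -
  have e: "representation Basis (p (q c)) b = (\<Sum>d\<in>Basis. representation Basis (q c) d * representation Basis (p d) b)"
    if "Vector_Spaces.linear scale scale p" for p q b c
  proof -
    have "Vector_Spaces.linear scale (*) (\<lambda>x. representation Basis (p x) b)"
      using Vector_Spaces.linear_compose[OF that functional_representation] by (simp add: o_def)
    from functional_expand[OF this] show ?thesis .
  qed
  have "full_trace (\<lambda>x. f (g x)) =
      (\<Sum>b\<in>Basis. \<Sum>d\<in>Basis. representation Basis (g b) d * representation Basis (f d) b)"
    unfolding full_trace_def by (rule sum.cong[OF refl]) (rule e[OF assms(1)])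
  also have "\<dots> = (\<Sum>d\<in>Basis. \<Sum>b\<in>Basis. representation Basis (f d) b * representation Basis (g b) d)"
    by (subst sum.swap) (simp only: mult.commute)
  also have "\<dots> = full_trace (\<lambda>x. g (f x))"
    unfolding full_trace_def by (rule sum.cong[OF refl]) (rule e[OF assms(2), symmetric])
  finally show ?thesis .
qed

text \<open>
  Expanding \<open>P x\<close> in a basis \<open>B\<close> of \<open>V\<close> exhibits \<open>f \<circ> P\<close> as the sum over \<open>b \<in> B\<close> of the rank one maps
  \<open>x \<mapsto> \<phi> b x \<cdot> f b\<close>, whose traces are \<open>\<phi> b (f b)\<close>.
\<close>
lemma trace_on_projection:
  assumes V: "subspace V"
    and f: "Vector_Spaces.linear scale scale f" "\<And>x. x \<in> V \<Longrightarrow> f x \<in> V"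
    and P: "Vector_Spaces.linear scale scale P" "\<And>x. P x \<in> V" "\<And>x. x \<in> V \<Longrightarrow> P x = x"
  shows "trace_on V f = full_trace (\<lambda>x. f (P x))"
proof -
  define B where "B = (SOME B. B \<subseteq> V \<and> independent B \<and> span B = V)"
  have "\<exists>B. B \<subseteq> V \<and> independent B \<and> span B = V"
  proof -
    obtain B where "B \<subseteq> V" "independent B" "V \<subseteq> span B" by (rule basis_exists[of V])
    then show ?thesis using span_minimal[OF _ V] by blast
  qed
  then have B: "B \<subseteq> V" "independent B" "span B = V" unfolding B_def by (rule someI2_ex; blast)+
  have finB: "finite B" using B(2) by (rule finiteI_independent)
  interpret P: Vector_Spaces.linear scale scale P by fact
  interpret f: Vector_Spaces.linear scale scale f by fact
  define \<phi> where "\<phi> b x = representation B (P x) b" for b x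
  have \<phi>: "Vector_Spaces.linear scale (*) (\<phi> b)" for b
    using functional_representation
    by (auto simp: Vector_Spaces.linear_iff \<phi>_def P.add P.scale representation_add representation_scale B P(2))
  have "full_trace (\<lambda>x. f (P x)) = (\<Sum>c\<in>Basis. \<Sum>b\<in>B. representation Basis (f b) c * \<phi> b c)"
    unfolding full_trace_def
  proof (rule sum.cong[OF refl])
    fix c
    interpret R: Vector_Spaces.linear scale "(*)" "\<lambda>x. representation Basis x c"
      by (rule functional_representation)
    have "P c = (\<Sum>b\<in>B. scale (\<phi> b c) b)"
      unfolding \<phi>_def by (subst sum_representation_eq[OF B(2)]) (simp_all add: B finB P(2))
    then have "f (P c) = (\<Sum>b\<in>B. scale (\<phi> b c) (f b))" by (simp add: f.sum f.scale)
    then show "representation Basis (f (P c)) c = (\<Sum>b\<in>B. representation Basis (f b) c * \<phi> b c)"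
      by (simp add: R.sum R.scale mult.commute)
  qed
  also have "\<dots> = (\<Sum>b\<in>B. \<phi> b (f b))"
    by (subst sum.swap) (simp add: functional_expand[OF \<phi>, symmetric])
  also have "\<dots> = (\<Sum>b\<in>B. representation B (f b) b)"
    using B f(2) by (auto simp: \<phi>_def P(3) intro!: sum.cong)
  finally show ?thesis by (simp add: trace_on_def B_def Let_def)
qed

end

section \<open>An integral constructed from the trace of the squared antipode\<close>

locale finite_dimensional_weak_hopf_algebra =
  weak_hopf_algebra scale \<Delta> \<epsilon> S + finite_dimensional_vector_space scale Basis
  for scale :: "'k::field \<Rightarrow> 'h::{ring, monoid_mult} \<Rightarrow> 'h" and \<Delta> \<epsilon> S and Basis
begin

text \<open>
  The element with \<open>f(r) = Tr(x \<mapsto> f(x\<^sub>2) S\<^sup>2(x\<^sub>1))\<close> for all linear functionals \<open>f\<close>; see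
  \<open>functional_trace_integral\<close>.
\<close>
definition trace_integral :: 'h where
  "trace_integral = (\<Sum>b\<in>Basis. sweedler b (\<lambda>b1 b2. scale (representation Basis (S (S b1)) b) b2))"

lemma scale_full_trace: "scale (full_trace f) v = (\<Sum>b\<in>Basis. scale (representation Basis (f b) b) v)"
  by (simp add: full_trace_def scale_sum_left)

lemma functional_trace_integral:
  assumes "functional f"
  shows "scale (f trace_integral) v =
    scale (full_trace (\<lambda>x. sweedler x (\<lambda>a b. scale (f b) (S (S a))))) v"
proof -
  have l1: "lin (\<lambda>x. scale (f x) v)" by (intro lin_functional assms lin_id)
  have l2: "lin (\<lambda>x. scale (representation Basis x b) v)" for b
    by (intro lin_functional functional_representation lin_id)
  interpret l1: Vector_Spaces.linear scale scale "\<lambda>x. scale (f x) v" by (rule l1)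
  interpret R: Vector_Spaces.linear scale "(*)" "\<lambda>x. representation Basis x b" for b
      by (rule functional_representation)
  show ?thesis
    unfolding trace_integral_def scale_full_trace l1.sum sweedler_push[OF l1] sweedler_push[OF l2]
    by (simp add: functionalD[OF assms] R.scale mult.commute)
qed

lemma eq_by_functionals:
  assumes "\<And>f v. functional f \<Longrightarrow> scale (f x) v = scale (f y) v"
  shows "x = y"
proof -
  have e: "w = (\<Sum>b\<in>Basis. scale (representation Basis w b) b)" for w
    by (subst sum_representation_eq[OF independent_Basis]) (simp_all add: span_Basis finite_Basis)
  show ?thesis
    by (rule trans[OF e[of x]], rule trans[OF _ e[of y, symmetric]]) (intro sum.cong refl assms functional_representation)
qed

lemma trace_sweedler:
  "scale (full_trace (\<lambda>x. sweedler h (\<beta> x))) v = sweedler h (\<lambda>a b. scale (full_trace (\<lambda>x. \<beta> x a b)) v)"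
proof -
  have l2: "lin (\<lambda>x. scale (representation Basis x b) v)" for b
    by (intro lin_functional functional_representation lin_id)
  have "sweedler h (\<lambda>a b. scale (full_trace (\<lambda>x. \<beta> x a b)) v) =
     (\<Sum>c\<in>Basis. sweedler h (\<lambda>a b. scale (representation Basis (\<beta> c a b) c) v))"
    unfolding scale_full_trace sweedler_def lin_ext_def
    by (subst sum.swap) (simp add: scale_sum_right case_prod_unfold)
  also have "\<dots> = scale (full_trace (\<lambda>x. sweedler h (\<beta> x))) v"
    unfolding scale_full_trace by (rule sum.cong[OF refl]) (rule sweedler_push[OF l2, symmetric])
  finally show ?thesis ..
qed

text \<open>
  Apply the cyclicity of the trace to \<open>x \<mapsto> F(x h\<^sub>2) S(h\<^sub>1)\<close>, with \<open>F(x) = f(x\<^sub>2) S\<^sup>2(x\<^sub>1)\<close>: right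
  multiplication by \<open>S(h\<^sub>1)\<close> moves inside \<open>F\<close> and meets \<open>h\<^sub>2\<close> there.
\<close>
lemma right_integral_trace_integral: "right_integral trace_integral"
  unfolding right_integral_def
proof (rule allI, rule eq_by_functionals)
  fix h f v assume f: "functional f"
  have fm: "functional (\<lambda>x. f (x * g))" for g
    using Vector_Spaces.linear_compose[OF lin_multr[OF lin_id] f] by (simp add: o_def)
  define F where "F x = sweedler x (\<lambda>a b. scale (f b) (S (S a)))" for x
  note I = lin_intros lin_functional[OF f]
  have lF: "lin F" unfolding F_def by (intro I)
  have "scale (f (trace_integral * h)) v =
     scale (full_trace (\<lambda>x. sweedler h (\<lambda>h1 h2. F (x * h2) * S h1))) v"
    unfolding functional_trace_integral[OF fm] F_def second_leg_mult_eq_untwisted[OF f, of _ h] ..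
  also have "\<dots> = sweedler h (\<lambda>h1 h2. scale (full_trace (\<lambda>x. F (x * h2) * S h1)) v)"
    by (rule trace_sweedler)
  also have "\<dots> = sweedler h (\<lambda>h1 h2. scale (full_trace (\<lambda>x. F (x * (S h1 * h2)))) v)"
  proof -
    have "full_trace (\<lambda>x. F (x * h2) * S h1) = full_trace (\<lambda>x. F (x * S h1 * h2))" for h1 h2
      using full_trace_comp[of "\<lambda>y. y * S h1" "\<lambda>x. F (x * h2)"]
      by (simp add: lin_multl lin_multr lin_id lin_comp[OF lF])
    then show ?thesis by (simp add: mult.assoc)
  qed
  also have "\<dots> = scale (full_trace (\<lambda>x. F (x * source_map h))) v"
  proof -
    have "lin (\<lambda>y. F (x * y))" for x by (intro lin_intros lin_comp[OF lF])
    from sweedler_push[OF this] show ?thesis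
      by (simp only: source_map_antipode[symmetric] trace_sweedler)
  qed
  also have "\<dots> = scale (f (trace_integral * source_map h)) v"
    unfolding functional_trace_integral[OF fm] F_def
    by (subst sweedler_mult_source) (intro I refl)+
  finally show "scale (f (trace_integral * h)) v = scale (f (trace_integral * source_map h)) v" .
qed

text \<open>
  For \<open>p\<close> in \<open>H\<^sub>s\<close> the sum \<open>\<epsilon>(x\<^sub>2 p) S\<^sup>2(x\<^sub>1)\<close> is \<open>\<epsilon>\<close> on the second leg of \<open>x p\<close>, hence \<open>S\<^sup>2(x p)\<close>.
\<close>
lemma counit_trace_integral:
  assumes p: "source_map p = p"
  shows "scale (\<epsilon> (source_map trace_integral * p)) v = scale (full_trace (\<lambda>x. S (S (x * p)))) v"
proof -
  have fp: "functional (\<lambda>x. \<epsilon> (x * p))"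
    using Vector_Spaces.linear_compose[OF lin_multr[OF lin_id] counit_linear] by (simp add: o_def)
  have "sweedler x (\<lambda>a b. scale (\<epsilon> (b * p)) (S (S a))) = S (S (x * p))" for x
  proof -
    have b: "bilin (\<lambda>a b. scale (\<epsilon> b) (S (S a)))" by (intro lin_intros)
    have l: "lin (\<lambda>x. S (S x))" by (intro lin_intros)
    have "sweedler x (\<lambda>a b. scale (\<epsilon> (b * p)) (S (S a))) = sweedler (x * p) (\<lambda>a b. scale (\<epsilon> b) (S (S a)))"
      using sweedler_mult_source[OF b, of x p] by (simp only: p)
    also have "\<dots> = S (S (sweedler (x * p) (\<lambda>a b. scale (\<epsilon> b) a)))"
      by (simp only: sweedler_push[OF l] linD[OF l])
    finally show ?thesis by (simp only: sweedler_counit)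
  qed
  with functional_trace_integral[OF fp, of v] show ?thesis by (simp add: counit_source)
qed

lemma trace_on_central_idempotent:
  assumes "\<And>h. p * h = h * p" "p * p = p" "S (S p) = p"
  shows "trace_on {p * h | h. True} (S \<circ> S) = full_trace (\<lambda>x. S (S (x * p)))"
proof -
  let ?V = "{p * h | h. True}"
  have V: "subspace ?V"
    by (auto intro!: subspaceI intro: exI[of _ 0] simp flip: distrib_left scale_mult_right)
  have "trace_on ?V (S \<circ> S) = full_trace (\<lambda>x. (S \<circ> S) (x * p))"
  proof (rule trace_on_projection[OF V])
    show "lin (S \<circ> S)" unfolding o_def by (intro lin_intros)
    show "lin (\<lambda>x. x * p)" by (intro lin_intros)
    show "(S \<circ> S) x \<in> ?V" if "x \<in> ?V" for x
      using that by (auto simp: antipode_mult assms(3))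
    show "x * p \<in> ?V" for x
      using assms(1)[of x, symmetric] by blast
    show "x * p = x" if x: "x \<in> ?V" for x
    proof -
      obtain h where h: "x = p * h" using x by blast
      then have "x * p = p * p * h" by (simp only: assms(1)[of h, symmetric] mult.assoc)
      then show ?thesis by (simp only: assms(2) h)
    qed
  qed
  then show ?thesis by simp
qed

section \<open>The central part of the source base\<close>

definition central_source :: "'h set" where
  "central_source = source_base \<inter> center"

lemma central_source_iff: "x \<in> central_source \<longleftrightarrow> source_map x = x \<and> (\<forall>h. x * h = h * x)"
proof -
  have "source_map (source_map h) = source_map h" for h
    using source_map_mult_left[of h 1] by simp
  then show ?thesis unfolding central_source_def source_base_def center_def by (auto simp: image_iff) metis
qed

lemma central_sourceD:
  assumes "x \<in> central_source"
  shows "source_map x = x" "x * h = h * x"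
  using assms by (simp_all add: central_source_iff)

lemma central_source_closed:
  "1 \<in> central_source"
  "x \<in> central_source \<Longrightarrow> y \<in> central_source \<Longrightarrow> x * y \<in> central_source"
  "subspace central_source"
proof -
  have l: "lin source_map" using lin_source[OF lin_id] by simp
  interpret l: Vector_Spaces.linear scale scale source_map by (rule l)
  show "1 \<in> central_source" by (simp add: central_source_iff)
  show "subspace central_source"
  proof (rule subspaceI)
    show "0 \<in> central_source" by (simp add: central_source_iff l.zero)
    fix x y c assume x: "x \<in> central_source" and y: "y \<in> central_source"
    show "x + y \<in> central_source"
      using central_sourceD[OF x] central_sourceD[OF y]
      by (simp only: central_source_iff l.add distrib_left distrib_right simp_thms)
    show "scale c x \<in> central_source"
      using central_sourceD[OF x]
      by (simp only: central_source_iff l.scale scale_mult_left scale_mult_right simp_thms)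
  qed
  assume x: "x \<in> central_source" and y: "y \<in> central_source"
  have "x * y * h = h * (x * y)" for h
  proof -
    have "x * y * h = x * h * y" by (simp only: central_sourceD(2)[OF y, of h] mult.assoc)
    also have "\<dots> = h * (x * y)" by (simp only: central_sourceD(2)[OF x, of h] mult.assoc)
    finally show ?thesis .
  qed
  moreover have "source_map (x * y) = x * y"
    using source_map_mult_source[of x y] by (simp only: central_sourceD(1)[OF x] central_sourceD(1)[OF y])
  ultimately show "x * y \<in> central_source" unfolding central_source_iff by blast
qed

text \<open>
  Let \<open>A\<close> be the algebra \<open>H\<^sub>s \<inter> Z(H)\<close>.  Since \<open>z \<in> z\<^sup>2 H\<close>, multiplication by \<open>z\<close> is injective on \<open>z A\<close>,
  so \<open>z\<^sup>2 A = z A\<close> by comparing dimensions.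
\<close>
lemma central_source_von_neumann_regular:
  assumes z: "z \<in> central_source"
  obtains w where "w \<in> central_source" "z = z * z * w"
proof -
  obtain v where v: "z = z * z * v"
    using central_source_divisible_by_square[OF central_sourceD[OF z]] .
  note zc = central_sourceD(2)[OF z]
  let ?f = "\<lambda>x. z * x"
  have l: "lin ?f" by (intro lin_intros)
  interpret l: Vector_Spaces.linear scale scale ?f by (rule l)
  interpret pair: finite_dimensional_vector_space_pair scale Basis scale Basis ..
  let ?V = "?f ` central_source"
  have V: "subspace ?V" by (rule l.subspace_image[OF central_source_closed(3)])
  have "inj_on ?f ?V"
  proof (rule inj_onI)
    fix x y assume "x \<in> ?V" "y \<in> ?V" and e: "z * x = z * y"
    then obtain x' y' where x: "x = z * x'" and y: "y = z * y'" by blast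
    have *: "z * u = v * (z * (z * u))" for u
    proof -
      have "z * u = z * z * v * u" by (rule arg_cong[OF v])
      also have "\<dots> = z * (z * v) * u" by (simp only: mult.assoc)
      also have "\<dots> = z * v * z * u" by (simp only: zc[of "z * v"])
      also have "\<dots> = v * z * z * u" by (simp only: zc[of v])
      finally show ?thesis by (simp only: mult.assoc)
    qed
    have "z * x' = v * (z * x)" unfolding x by (rule *)
    also have "\<dots> = z * y'" unfolding e y by (rule *[symmetric])
    finally show "x = y" by (simp only: x y)
  qed
  then have "dim (?f ` ?V) = dim ?V"
    using pair.dim_image_eq[OF l, of ?V] V by (simp only: span_eq_iff[THEN iffD2])
  moreover have "?f ` ?V \<subseteq> ?V" using central_source_closed(2)[OF z] by blast
  ultimately have "?f ` ?V = ?V"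
    using subspace_dim_equal[of "?f ` ?V" ?V] V l.subspace_image[OF V] by simp
  moreover have "z \<in> ?V" using central_source_closed(1) by (intro image_eqI[of _ _ 1]) simp_all
  ultimately obtain w where "w \<in> central_source" "z = z * (z * w)" by blast
  then show ?thesis by (intro that) (simp_all add: mult.assoc)
qed

text \<open>
  By induction on the dimension of \<open>e H\<close>: if \<open>e = f + g\<close> with nonzero orthogonal idempotents, then
  \<open>f H\<close> is a proper subspace of \<open>e H\<close>, since it misses \<open>g\<close>.
\<close>
lemma primitive_idempotent_below:
  assumes "e \<in> central_source" "e * e = e" "e \<noteq> 0"
  shows "\<exists>p \<in> primitive_idempotents central_source. p * e = p"
  using assms
proof (induction "dim (range ((*) e))" arbitrary: e rule: less_induct)
  case less
  have sub: "subspace (range ((*) y))" for y :: 'h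
  proof -
    have l: "lin ((*) y)" using lin_multl[OF lin_id] by simp
    interpret l: Vector_Spaces.linear scale scale "(*) y" by (rule l)
    show ?thesis by (rule l.subspace_image) (rule subspace_UNIV)
  qed
  show ?case
  proof (cases "e \<in> primitive_idempotents central_source")
    case True
    then show ?thesis using less.prems by blast
  next
    case False
    then obtain f g where f: "f \<in> central_source" "f * f = f" "f \<noteq> 0"
      and g: "g * g = g" "g \<noteq> 0" and fg: "f * g = 0" "g * f = 0" and e: "e = f + g"
      using less.prems unfolding primitive_idempotents_def by blast
    have fe: "f * e = f" "e * f = f" "e * g = g" using f(2) g(1) fg by (simp_all add: e algebra_simps)
    have "range ((*) f) \<subseteq> range ((*) e)"
    proof safe
      fix h have "f * h = e * (f * h)" using fe(2) by (simp flip: mult.assoc)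
      then show "f * h \<in> range ((*) e)" by blast
    qed
    moreover have "g \<in> range ((*) e)" by (rule image_eqI[of _ _ g]) (simp_all add: fe(3))
    moreover have "g \<notin> range ((*) f)"
    proof
      assume "g \<in> range ((*) f)"
      then obtain h where "g = f * h" by blast
      then have "f * g = g" using f(2) by (simp flip: mult.assoc)
      then show False using fg g by simp
    qed
    ultimately have "range ((*) f) \<subset> range ((*) e)" by blast
    then have "dim (range ((*) f)) < dim (range ((*) e))"
      by (intro dim_psubset) (simp add: span_eq_iff[THEN iffD2, OF sub])
    from less.hyps[OF this f] obtain p where p: "p \<in> primitive_idempotents central_source" "p * f = p"
      by blast
    have "p * e = p * (f * e)" by (simp only: p(2) mult.assoc[symmetric])
    then have "p * e = p" by (simp only: fe(1) p(2))
    then show ?thesis using p(1) by blast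
  qed
qed

lemma one_mem_target_base: "1 \<in> target_base"
  unfolding target_base_def by (rule image_eqI[of _ _ 1]) simp_all

lemma source_subset_minimal: "source_base \<subseteq> minimal_part"
  unfolding minimal_part_def using one_mem_target_base by (auto intro!: span_base) (metis mult_1_left)

text \<open>
  With \<open>z = z\<^sup>2 w\<close> the element \<open>e = 1 - z w\<close> is an idempotent annihilated by \<open>z\<close>, and it vanishes exactly
  if \<open>z\<close> is invertible with inverse \<open>w\<close>.
\<close>
lemma semisimple_if_traces_nonzero:
  assumes S2: "\<forall>x \<in> minimal_part. S (S x) = x"
    and tr: "\<forall>p \<in> primitive_idempotents central_source. trace_on {p * h | h. True} (S \<circ> S) \<noteq> 0"
  shows semisimple
proof -
  let ?r = trace_integral
  define z where "z = source_map ?r"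
  have r: "right_integral ?r" by (rule right_integral_trace_integral)
  have z: "z \<in> central_source"
    unfolding z_def central_source_def center_def source_base_def using integral_source_central[OF r] by simp
  then obtain w where w: "w \<in> central_source" "z = z * z * w"
    by (rule central_source_von_neumann_regular)
  define e where "e = 1 - z * w"
  note zc = central_sourceD(2)[OF z] and wc = central_sourceD(2)[OF w(1)]
  have ze: "z * e = 0" using w(2) by (simp add: e_def right_diff_distrib flip: mult.assoc)
  have e: "e \<in> central_source"
    unfolding e_def using central_source_closed z w by (intro subspace_diff) simp_all
  have ee: "e * e = e"
  proof -
    have "e * e = e - z * w * e" by (simp add: e_def left_diff_distrib)
    also have "z * w * e = w * (z * e)" by (simp only: wc[of z, symmetric] mult.assoc)
    finally show ?thesis by (simp add: ze)
  qed
  have "e = 0"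
  proof (rule ccontr)
    assume "e \<noteq> 0"
    then obtain p where p: "p \<in> primitive_idempotents central_source" "p * e = p"
      using primitive_idempotent_below[OF e ee] by blast
    then have pA: "p \<in> central_source" "p * p = p" "p \<noteq> 0" by (auto simp: primitive_idempotents_def)
    have "z * p = p * (e * z)" by (simp only: zc[of p] mult.assoc[symmetric] p(2))
    then have "z * p = 0" by (simp only: zc[of e, symmetric] ze mult_zero_right)
    moreover have "\<epsilon> 0 = 0" using functionalD(2)[OF counit_linear, of 0 0] by simp
    ultimately have "scale (full_trace (\<lambda>x. S (S (x * p)))) p = 0"
      using counit_trace_integral[OF central_sourceD(1)[OF pA(1)], of p] by (simp add: z_def)
    then have "full_trace (\<lambda>x. S (S (x * p))) = 0" using pA(3) by simp
    moreover have "S (S p) = p" using S2 source_subset_minimal pA(1) by (auto simp: central_source_def)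
    ultimately show False
      using tr p(1) trace_on_central_idempotent[OF central_sourceD(2)[OF pA(1)] pA(2)] by simp
  qed
  then have "z * w = 1" by (simp add: e_def)
  then show ?thesis using semisimple_of_integral[OF r _ wc] by (simp add: z_def)
qed

end

theorem proposition6p4:
  fixes scale :: "'k::{alg_closed_field, field_char_0} \<Rightarrow> 'h::{ring, monoid_mult} \<Rightarrow> 'h"
    and \<Delta> :: "'h \<Rightarrow> ('k, 'h) tensor2"
    and \<epsilon> :: "'h \<Rightarrow> 'k"
    and S :: "'h \<Rightarrow> 'h"
    and Basis :: "'h set"
  assumes "weak_hopf_algebra scale \<Delta> \<epsilon> S"
    and "finite_dimensional_vector_space scale Basis"
    and "algebra_over.frobenius scale"
    and "\<forall>x \<in> weak_hopf_algebra.minimal_part scale \<Delta> \<epsilon>. S (S x) = x"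
    and "\<forall>p \<in> primitive_idempotents (weak_hopf_algebra.source_base scale \<Delta> \<epsilon> \<inter> center).
           vector_space.trace_on scale {p * h | h. True} (S \<circ> S) \<noteq> 0"
  shows "algebra_over.semisimple scale"
proof -
  interpret finite_dimensional_weak_hopf_algebra scale \<Delta> \<epsilon> S Basis
    using assms(1,2) by (rule finite_dimensional_weak_hopf_algebra.intro)
  show ?thesis using assms(4,5) unfolding central_source_def[symmetric]
    by (rule semisimple_if_traces_nonzero)
qed

end
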